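(* Let $H$ be a Hilbert space, $F=L+Q$ a permissible decomposition of a permissible vector field on $H$, $\eta$ the flow generated by $F$, and $X\subset H$ an isolating neighborhood for $\eta$. There exist (sufficiently small) positive real numbers $c_1,c_2$ such that the following holds. Call a finite-dimensional subspace $V\subset H$ suitable if (1) $V$ contains $\ker L$, (2) $\|\pi_VL-L\pi_V\|\le c_1$, (3) $\sup_{x\in X}\|(1-\pi_V)Qx\|\le c_2$. Then for every suitable $V$ the Conley index $\mathcal I(X\cap V,\eta_V)$ is defined (i.e. $X$ is an isolating neighborhood for $\eta_V$, so that $X\cap V$ is an isolating neighborhood for $\eta_V$ restricted to $V$). In addition, if $V$ and $W$ are two suitable subspaces and $W=V\oplus U$ is an orthogonal decomposition, then $\pi_UL|_U:U\to U$ has no kernel, and $X$ is an isolating neighborhood for the family of flows generated by $sF_{V,W}+(1-s)F_W$, i.e. for each $s\in[0,1]$ it is an isolating neighborhood for the flow generated by $sF_{V,W}+(1-s)F_W$.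
   Context: $H$ is a Hilbert space. A map is compact if it is continuous and sends bounded sets to precompact sets. A vector field on $H$ is a continuous map $F:H\to H$. It is permissible if it admits a permissible decomposition $F=L+Q$, meaning: (1) $L$ is a bounded self-adjoint Fredholm operator on $H$; (2) $Q:H\to H$ is locally Lipschitz and compact (possibly nonlinear); (3) there are positive constants $a_1,a_2$ with $\|Q(x)\|\le a_1\|x\|+\frac{a_2}{1+\|x\|}$ for all $x\in H$. The flow generated by a vector field $G$ is the solution $\eta$ of $\frac{\partial}{\partial t}\eta(x,t)=-G(\eta(x,t))$, $\eta(x,0)=x$. For $X\subset H$, $\operatorname{Inv}(X,\eta)=\{x\in X:\eta(x,t)\in X\ \forall t\in\mathbb R\}$. A closed and bounded subset $X\subset H$ is an isolating neighborhood for $\eta$ if $\operatorname{Inv}(X,\eta)\subset\operatorname{Int}(X)$; the same definition applies within a finite-dimensional subspace, with the interior taken there. $\pi_V$ denotes the orthogonal projection of $H$ onto a finite-dimensional subspace $V$. The flow $\eta_V$ is generated by $F_V=\pi_VL\pi_V+(1-\pi_V)L(1-\pi_V)+\pi_VQ$ (and $F_W$ is defined likewise); $\eta_V$ preserves $V$. For an orthogonal decomposition $W=V\oplus U$, $F_{V,W}=\pi_VL\pi_V+\pi_UL\pi_U+(1-\pi_W)L(1-\pi_W)+\pi_VQ$. The Conley index $\mathcal I(X\cap V,\eta_V)$ is the classical homotopy Conley index of the compact isolating neighborhood $X\cap V$ for the flow $\eta_V$ restricted to $V$. *)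

theory Defs
  imports "HOL-Analysis.Analysis"
begin

text \<open>
  Hilbert spaces are types of class \<open>{real_inner, complete_space}\<close>. Neither separability nor
  infinite dimension is assumed.
\<close>

subsection \<open>Linear algebra and operators\<close>

text \<open>The library's \<^const>\<open>dim\<close> is 0 on infinite-dimensional subspaces, so finite dimension is
  expressed by a finite spanning set.\<close>

definition finite_dim_subspace :: "'a::real_vector set \<Rightarrow> bool" where
  "finite_dim_subspace V \<longleftrightarrow> (\<exists>B. finite B \<and> V = span B)"

text \<open>Meaningful on closed subspaces of a Hilbert space, in particular finite-dimensional ones,
  where the point \<open>p\<close> exists and is unique. The library's \<open>closest_point\<close> is not used because its
  class constraint \<open>heine_borel\<close> forces finite dimension.\<close>

definition orth_proj :: "'a::real_inner set \<Rightarrow> 'a \<Rightarrow> 'a" where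
  "orth_proj V x = (THE p. p \<in> V \<and> (\<forall>v\<in>V. orthogonal (x - p) v))"

definition orth_decomp :: "'a::real_inner set \<Rightarrow> 'a set \<Rightarrow> 'a set \<Rightarrow> bool" where
  "orth_decomp W V U \<longleftrightarrow>
     subspace V \<and> subspace U \<and> (\<forall>v\<in>V. \<forall>u\<in>U. orthogonal v u) \<and>
     W = {v + u |v u. v \<in> V \<and> u \<in> U}"

text \<open>The last conjunct says that the cokernel is finite-dimensional.\<close>

definition fredholm :: "('a::real_normed_vector \<Rightarrow> 'b::real_normed_vector) \<Rightarrow> bool" where
  "fredholm L \<longleftrightarrow>
     bounded_linear L \<and> finite_dim_subspace {x. L x = 0} \<and> closed (range L) \<and>
     (\<exists>C. finite_dim_subspace C \<and> (\<forall>y. \<exists>x. \<exists>c\<in>C. y = L x + c))"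

definition self_adjoint :: "('a::real_inner \<Rightarrow> 'a) \<Rightarrow> bool" where
  "self_adjoint L \<longleftrightarrow> (\<forall>x y. L x \<bullet> y = x \<bullet> L y)"

definition compact_operator :: "('a::real_normed_vector \<Rightarrow> 'b::real_normed_vector) \<Rightarrow> bool" where
  "compact_operator Q \<longleftrightarrow>
     continuous_on UNIV Q \<and> (\<forall>B. bounded B \<longrightarrow> compact (closure (Q ` B)))"

text \<open>The library's \<^const>\<open>local_lipschitz\<close> is for time-dependent maps; here it is applied to a
  map that does not depend on time.\<close>

definition permissible_decomposition ::
    "('a::{real_inner, complete_space} \<Rightarrow> 'a) \<Rightarrow> ('a \<Rightarrow> 'a) \<Rightarrow> ('a \<Rightarrow> 'a) \<Rightarrow> bool" where
  "permissible_decomposition F L Q \<longleftrightarrow>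
     (\<forall>x. F x = L x + Q x) \<and>
     bounded_linear L \<and> self_adjoint L \<and> fredholm L \<and>
     local_lipschitz (UNIV :: real set) UNIV (\<lambda>_. Q) \<and> compact_operator Q \<and>
     (\<exists>a1>0. \<exists>a2>0. \<forall>x. norm (Q x) \<le> a1 * norm x + a2 / (1 + norm x))"


subsection \<open>Flows and isolating neighborhoods\<close>

text \<open>Note the sign convention: the flow solves \<open>x' = - G x\<close>, for all times.\<close>

definition generates_flow :: "('a::real_normed_vector \<Rightarrow> 'a) \<Rightarrow> ('a \<Rightarrow> real \<Rightarrow> 'a) \<Rightarrow> bool" where
  "generates_flow G \<eta> \<longleftrightarrow>
     (\<forall>x. \<eta> x 0 = x \<and> (\<forall>t. (\<eta> x has_vector_derivative - G (\<eta> x t)) (at t)))"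

definition inv_set :: "'a set \<Rightarrow> ('a \<Rightarrow> real \<Rightarrow> 'a) \<Rightarrow> 'a set" where
  "inv_set X \<eta> = {x \<in> X. \<forall>t. \<eta> x t \<in> X}"

text \<open>\<open>S\<close> is the ambient space: \<^const>\<open>UNIV\<close> for the Hilbert space itself, or a
  finite-dimensional subspace; closedness and interior are relative to \<open>S\<close>.\<close>

definition isolating_nbhd_in ::
    "'a::real_normed_vector set \<Rightarrow> 'a set \<Rightarrow> ('a \<Rightarrow> real \<Rightarrow> 'a) \<Rightarrow> bool" where
  "isolating_nbhd_in S X \<eta> \<longleftrightarrow>
     closedin (top_of_set S) X \<and> bounded X \<and>
     inv_set X \<eta> \<subseteq> (top_of_set S) interior_of X"

text \<open>The classical homotopy Conley index of \<open>X \<inter> V\<close> for \<open>\<eta>\<close> restricted to \<open>V\<close> is defined exactly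
  when \<open>\<eta>\<close> restricts to the finite-dimensional space \<open>V\<close> and \<open>X \<inter> V\<close> is a compact isolating
  neighborhood for the restricted flow.\<close>

definition conley_index_defined ::
    "'a::real_inner set \<Rightarrow> 'a set \<Rightarrow> ('a \<Rightarrow> real \<Rightarrow> 'a) \<Rightarrow> bool" where
  "conley_index_defined V X \<eta> \<longleftrightarrow>
     finite_dim_subspace V \<and> (\<forall>x\<in>V. \<forall>t. \<eta> x t \<in> V) \<and>
     compact (X \<inter> V) \<and> isolating_nbhd_in V (X \<inter> V) \<eta>"


subsection \<open>Finite-dimensional approximation\<close>

definition approx_field :: "('a::real_inner \<Rightarrow> 'a) \<Rightarrow> ('a \<Rightarrow> 'a) \<Rightarrow> 'a set \<Rightarrow> 'a \<Rightarrow> 'a" where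
  "approx_field L Q V x =
     (let p = orth_proj V in
      p (L (p x)) + (L (x - p x) - p (L (x - p x))) + p (Q x))"

text \<open>The field \<open>F\<^bsub>V,W\<^esub>\<close> for \<open>W = V \<oplus> U\<close>.\<close>

definition approx_field2 ::
    "('a::real_inner \<Rightarrow> 'a) \<Rightarrow> ('a \<Rightarrow> 'a) \<Rightarrow> 'a set \<Rightarrow> 'a set \<Rightarrow> 'a set \<Rightarrow> 'a \<Rightarrow> 'a" where
  "approx_field2 L Q V U W x =
     (let p = orth_proj V; q = orth_proj U; r = orth_proj W in
      p (L (p x)) + q (L (q x)) + (L (x - r x) - r (L (x - r x))) + p (Q x))"

text \<open>The supremum is taken in the extended reals so that it also makes sense for empty \<open>X\<close>.\<close>

definition suitable ::
    "('a::real_inner \<Rightarrow> 'a) \<Rightarrow> ('a \<Rightarrow> 'a) \<Rightarrow> 'a set \<Rightarrow> real \<Rightarrow> real \<Rightarrow> 'a set \<Rightarrow> bool" where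
  "suitable L Q X c1 c2 V \<longleftrightarrow>
     finite_dim_subspace V \<and>
     {x. L x = 0} \<subseteq> V \<and>
     onorm (\<lambda>x. orth_proj V (L x) - L (orth_proj V x)) \<le> c1 \<and>
     (SUP x\<in>X. ereal (norm (Q x - orth_proj V (Q x)))) \<le> ereal c2"

end

theory Submission
  imports Defs
begin

text \<open>
  The idea is that isolation is an open condition on the field: there is \<open>\<epsilon> > 0\<close> such that
  \<open>X\<close> is an isolating neighborhood for the flow of every field \<open>G\<close> that differs from
  \<open>F = L + Q\<close> by at most \<open>\<epsilon>\<close> on \<open>X\<close> (\<open>isolation_stable\<close>). All fields in the
  theorem are of this kind. The off-diagonal blocks of \<open>L\<close> with respect to \<open>V\<close> are
  commutators of \<open>L\<close> with the projection, hence bounded by \<open>c1\<close>, and on \<open>X\<close> the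
  projection changes \<open>Q\<close> by at most \<open>c2\<close>. So the fields differ from \<open>F\<close> by at most
  \<open>4 c1 R + c2\<close> on \<open>X\<close>, where \<open>R\<close> bounds the norm on \<open>X\<close>
  (\<open>approx_field_near\<close>, \<open>approx_field2_near\<close>).

  In infinite dimensions openness is not automatic, because \<open>X\<close> need not be compact. What replaces
  compactness of \<open>X\<close> is that the full trajectories inside \<open>X\<close> form a precompact family,
  uniformly for all fields near \<open>F\<close> (\<open>bounded_solutions_precompact\<close>). Such a
  trajectory solves \<open>\<gamma>' = - L \<gamma> - h\<close>, where the values of \<open>h\<close> are near the
  relatively compact set \<open>Q ` X\<close>. Up to errors near a compact set, \<open>\<gamma> 0\<close> is therefore
  determined by \<open>\<gamma> T\<close> and also by \<open>\<gamma> (- T)\<close>. Two solutions with approximately the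
  same errors have initial points whose difference \<open>z\<close> remains bounded under the group generated by
  \<open>L\<close> at the times \<open>T\<close> and \<open>- T\<close>. But the sum of the squares of the norms at these
  times is at least \<open>4 T^2 (norm (L z))^2\<close> (\<open>group_expansion\<close>), so \<open>L z\<close> is small when
  \<open>T\<close> is large. Finally \<open>L\<close> is bounded below on the orthogonal complement of its
  finite-dimensional kernel (\<open>self_adjoint_closed_range_bounded_below\<close>), which makes \<open>z\<close>
  small as well.

  The same lower bound shows that \<open>U\<close>, being orthogonal to the kernel of \<open>L\<close>, contains no
  kernel of the compression of \<open>L\<close> once \<open>c1\<close> is small (\<open>complement_no_kernel\<close>). The
  remaining work is analysis in Hilbert space: orthogonal projections, and the existence and
  uniqueness of flows for locally Lipschitz fields of linear growth (\<open>flow_exists_unique\<close>).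
  There \<open>F\<close> need not be Lipschitz on bounded sets, so solutions are prolonged from local ones.
\<close>

section \<open>Projections and finite-dimensional subspaces\<close>

lemma orth_proj_eqI:
  assumes V: "subspace V" and p: "p \<in> V" and orth: "\<And>v. v \<in> V \<Longrightarrow> (x - p) \<bullet> v = 0"
  shows "orth_proj V x = p"
  unfolding orth_proj_def
proof (rule the_equality)
  show "p \<in> V \<and> (\<forall>v\<in>V. orthogonal (x - p) v)"
    using p orth by (simp add: orthogonal_def)
  fix q assume q: "q \<in> V \<and> (\<forall>v\<in>V. orthogonal (x - q) v)"
  have "p - q \<in> V" using V p q by (simp add: subspace_diff)
  then have "(x - q) \<bullet> (p - q) - (x - p) \<bullet> (p - q) = 0"
    using q orth by (simp add: orthogonal_def)
  then have "(p - q) \<bullet> (p - q) = 0" by (simp add: inner_diff_left algebra_simps)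
  then show "q = p" by simp
qed

lemma finite_dim_subspace_imp_subspace: "finite_dim_subspace V \<Longrightarrow> subspace V"
  by (auto simp: finite_dim_subspace_def)

text \<open>A zero vector in \<open>C\<close> is harmless: its coefficient is \<open>0 / 0 = 0\<close>. This is why
  \<open>C\<close> may be any orthogonal family, as the Gram-Schmidt process yields it.\<close>

lemma orthogonal_expansion_residual:
  fixes C :: "'a::real_inner set"
  assumes C: "finite C" "pairwise orthogonal C" and v: "v \<in> span C"
  shows "(x - (\<Sum>b\<in>C. ((b \<bullet> x) / (b \<bullet> b)) *\<^sub>R b)) \<bullet> v = 0"
proof -
  have "orthogonal (x - (\<Sum>b\<in>C. ((b \<bullet> x) / (b \<bullet> b)) *\<^sub>R b)) y" if "y \<in> C" for y
  proof -
    have "(\<Sum>b\<in>C. ((b \<bullet> x) / (b \<bullet> b)) * (b \<bullet> y)) = (\<Sum>b\<in>C. if b = y then b \<bullet> x else 0)"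
      using C(2) that by (intro sum.cong refl) (auto simp: pairwise_def orthogonal_def)
    also have "\<dots> = x \<bullet> y" using C(1) that by (simp add: inner_commute)
    finally show ?thesis by (simp add: orthogonal_def inner_diff_left inner_sum_left)
  qed
  then show ?thesis
    using orthogonal_to_span[OF v] unfolding orthogonal_def[symmetric] by blast
qed

lemma finite_dim_orthogonal_basis:
  fixes V :: "'a::real_inner set"
  assumes "finite_dim_subspace V"
  obtains C where "finite C" "V = span C" "pairwise orthogonal C"
    "orth_proj V = (\<lambda>x. \<Sum>b\<in>C. ((b \<bullet> x) / (b \<bullet> b)) *\<^sub>R b)"
proof -
  obtain B where "finite B" "V = span B" using assms by (auto simp: finite_dim_subspace_def)
  then obtain C where C: "finite C" "V = span C" "pairwise orthogonal C"
    using basis_orthogonal[of B] by auto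
  have "orth_proj V x = (\<Sum>b\<in>C. ((b \<bullet> x) / (b \<bullet> b)) *\<^sub>R b)" for x
  proof (rule orth_proj_eqI)
    show "subspace V" by (simp add: C)
    show "(\<Sum>b\<in>C. ((b \<bullet> x) / (b \<bullet> b)) *\<^sub>R b) \<in> V"
      unfolding C(2) by (intro span_sum span_scale span_base)
    show "(x - (\<Sum>b\<in>C. ((b \<bullet> x) / (b \<bullet> b)) *\<^sub>R b)) \<bullet> v = 0" if "v \<in> V" for v
      using that unfolding C(2) by (rule orthogonal_expansion_residual[OF C(1,3)])
  qed
  with C show thesis using that by blast
qed

context
  fixes V :: "'a::real_inner set"
  assumes V: "finite_dim_subspace V"
begin

lemma orth_proj_in: "orth_proj V x \<in> V"
proof -
  obtain C where "finite C" "V = span C" "pairwise orthogonal C"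
    "orth_proj V = (\<lambda>x. \<Sum>b\<in>C. ((b \<bullet> x) / (b \<bullet> b)) *\<^sub>R b)"
    using finite_dim_orthogonal_basis[OF V] by blast
  then show ?thesis by (auto intro: span_base span_scale span_sum)
qed

lemma orth_proj_fixes: "v \<in> V \<Longrightarrow> orth_proj V v = v"
  by (rule orth_proj_eqI) (auto simp: finite_dim_subspace_imp_subspace[OF V])

lemma linear_orth_proj: "linear (orth_proj V)"
proof -
  obtain C where C: "finite C"
    "orth_proj V = (\<lambda>x. \<Sum>b\<in>C. ((b \<bullet> x) / (b \<bullet> b)) *\<^sub>R b)"
    using finite_dim_orthogonal_basis[OF V] by blast
  show ?thesis unfolding C(2)
    by (intro linearI)
       (simp_all add: inner_add_right add_divide_distrib scaleR_add_left sum.distrib scaleR_sum_right)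
qed

lemma orth_proj_orthogonal: "v \<in> V \<Longrightarrow> (x - orth_proj V x) \<bullet> v = 0"
proof -
  assume v: "v \<in> V"
  obtain C where C: "finite C" "V = span C" "pairwise orthogonal C"
    "orth_proj V = (\<lambda>x. \<Sum>b\<in>C. ((b \<bullet> x) / (b \<bullet> b)) *\<^sub>R b)"
    using finite_dim_orthogonal_basis[OF V] by blast
  from v show ?thesis
    unfolding C(4) unfolding C(2) by (rule orthogonal_expansion_residual[OF C(1,3)])
qed

lemma orth_proj_pythagoras: "(norm x)\<^sup>2 = (norm (orth_proj V x))\<^sup>2 + (norm (x - orth_proj V x))\<^sup>2"
proof -
  have "orth_proj V x \<bullet> (x - orth_proj V x) = 0"
    using orth_proj_orthogonal[OF orth_proj_in] by (simp add: inner_commute)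
  then have "(norm (orth_proj V x + (x - orth_proj V x)))\<^sup>2
      = (norm (orth_proj V x))\<^sup>2 + (norm (x - orth_proj V x))\<^sup>2"
    by (intro norm_add_Pythagorean) (simp add: orthogonal_def)
  then show ?thesis by simp
qed

lemma norm_orth_proj_le: "norm (orth_proj V x) \<le> norm x"
  by (rule power2_le_imp_le[OF _ norm_ge_zero]) (simp add: orth_proj_pythagoras[of x])

lemma norm_orth_proj_compl_le: "norm (x - orth_proj V x) \<le> norm x"
  by (rule power2_le_imp_le[OF _ norm_ge_zero]) (simp add: orth_proj_pythagoras[of x])

lemma bounded_linear_orth_proj: "bounded_linear (orth_proj V)"
  using linear_orth_proj norm_orth_proj_le
  by (intro bounded_linear_intro[where K = 1]) (auto simp: linear_add linear_scale)

lemma orth_proj_eq_0: "(\<And>v. v \<in> V \<Longrightarrow> x \<bullet> v = 0) \<Longrightarrow> orth_proj V x = 0"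
  by (intro orth_proj_eqI)
     (auto simp: finite_dim_subspace_imp_subspace[OF V] subspace_0)

lemma closed_finite_dim_subspace: "closed V"
proof -
  have "x \<in> V \<longleftrightarrow> orth_proj V x = x" for x
    using orth_proj_in[of x] orth_proj_fixes[of x] by fastforce
  then have "V = {x. orth_proj V x = x}" by blast
  moreover have "closed {x. orth_proj V x = x}"
    using bounded_linear_orth_proj
    by (intro closed_Collect_eq continuous_intros linear_continuous_on) auto
  ultimately show ?thesis by simp
qed

end

text \<open>Adding one basis vector turns the set into the image of a product of an interval with the
  previous set under a continuous map.\<close>

lemma compact_bounded_coefficients:
  fixes C :: "'a::real_normed_vector set"
  assumes "finite C"
  shows "compact {\<Sum>b\<in>C. u b *\<^sub>R b |u. \<forall>b\<in>C. \<bar>u b\<bar> \<le> (r::real)}"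
  using assms
proof (induction C)
  case empty
  then show ?case by simp
next
  case (insert a C)
  let ?K = "{\<Sum>b\<in>C. u b *\<^sub>R b |u. \<forall>b\<in>C. \<bar>u b\<bar> \<le> r}"
  let ?f = "\<lambda>(t, x). t *\<^sub>R a + x"
  have "?f ` ({-r..r} \<times> ?K) = {\<Sum>b\<in>insert a C. u b *\<^sub>R b |u. \<forall>b\<in>insert a C. \<bar>u b\<bar> \<le> r}"
    (is "?A = ?B")
  proof
    show "?A \<subseteq> ?B"
    proof safe
      fix t u assume t: "t \<in> {-r..r}" and u: "\<forall>b\<in>C. \<bar>u b\<bar> \<le> r"
      have "(\<Sum>b\<in>C. (u(a := t)) b *\<^sub>R b) = (\<Sum>b\<in>C. u b *\<^sub>R b)"
        using insert.hyps by (intro sum.cong) auto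
      then show "\<exists>w. t *\<^sub>R a + (\<Sum>b\<in>C. u b *\<^sub>R b) = (\<Sum>b\<in>insert a C. w b *\<^sub>R b)
          \<and> (\<forall>b\<in>insert a C. \<bar>w b\<bar> \<le> r)"
        using t u insert.hyps by (intro exI[of _ "u(a := t)"]) auto
    qed
    show "?B \<subseteq> ?A"
    proof safe
      fix u assume u: "\<forall>b\<in>insert a C. \<bar>u b\<bar> \<le> r"
      have "(\<Sum>b\<in>insert a C. u b *\<^sub>R b) = ?f (u a, \<Sum>b\<in>C. u b *\<^sub>R b)"
        using insert.hyps by simp
      then show "(\<Sum>b\<in>insert a C. u b *\<^sub>R b) \<in> ?A"
        using u by (intro image_eqI[where x = "(u a, \<Sum>b\<in>C. u b *\<^sub>R b)"]) auto
    qed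
  qed
  moreover have "compact ?A"
    unfolding case_prod_unfold
    by (intro compact_continuous_image compact_Times insert.IH continuous_intros) simp
  ultimately show ?case by simp
qed

text \<open>The coefficients of the elements of \<open>S\<close> with respect to an orthogonal basis are bounded, so
  \<open>S\<close> is a closed part of one of the compact sets of the previous lemma.\<close>

lemma finite_dim_compact:
  fixes V :: "'a::real_inner set"
  assumes V: "finite_dim_subspace V" and S: "S \<subseteq> V" "closed S" "bounded S"
  shows "compact S"
proof -
  obtain C where C: "finite C" "orth_proj V = (\<lambda>x. \<Sum>b\<in>C. ((b \<bullet> x) / (b \<bullet> b)) *\<^sub>R b)"
    using finite_dim_orthogonal_basis[OF V] by blast
  obtain R where R: "R > 0" "\<And>x. x \<in> S \<Longrightarrow> norm x \<le> R" using S(3) by (auto simp: bounded_pos)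
  define r where "r = (\<Sum>b\<in>C. R / norm b)"
  have "\<bar>(b \<bullet> x) / (b \<bullet> b)\<bar> \<le> r" if "x \<in> S" "b \<in> C" for x b
  proof -
    have "\<bar>(b \<bullet> x) / (b \<bullet> b)\<bar> \<le> (norm b * norm x) / (norm b * norm b)"
      unfolding abs_divide dot_square_norm power2_eq_square abs_mult abs_norm_cancel
      by (intro divide_right_mono Cauchy_Schwarz_ineq2) simp
    also have "\<dots> = norm x / norm b" by simp
    also have "\<dots> \<le> R / norm b" using R(2)[OF that(1)] by (simp add: divide_right_mono)
    also have "\<dots> \<le> r" unfolding r_def
      using C(1) that(2) R(1) by (intro member_le_sum) auto
    finally show ?thesis .
  qed
  then have coeff: "\<forall>b\<in>C. \<bar>(b \<bullet> x) / (b \<bullet> b)\<bar> \<le> r" if "x \<in> S" for x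
    using that by blast
  have "\<exists>u. x = (\<Sum>b\<in>C. u b *\<^sub>R b) \<and> (\<forall>b\<in>C. \<bar>u b\<bar> \<le> r)" if "x \<in> S" for x
  proof (intro exI conjI)
    have "orth_proj V x = x" using S(1) that by (intro orth_proj_fixes[OF V]) auto
    then show "x = (\<Sum>b\<in>C. ((b \<bullet> x) / (b \<bullet> b)) *\<^sub>R b)" 
      by (simp only: C(2))
  qed (rule coeff[OF that])
  then have sub: "S \<subseteq> {\<Sum>b\<in>C. u b *\<^sub>R b |u. \<forall>b\<in>C. \<bar>u b\<bar> \<le> r}"
    by blast
  have "compact ({\<Sum>b\<in>C. u b *\<^sub>R b |u. \<forall>b\<in>C. \<bar>u b\<bar> \<le> r} \<inter> S)"
    by (rule compact_Int_closed[OF compact_bounded_coefficients[OF C(1)] S(2)])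
  then show ?thesis by (simp only: Int_absorb1[OF sub])
qed

section \<open>Consequences of completeness\<close>

text \<open>The points of \<open>R\<close> that almost realise the distance from \<open>x\<close> form a decreasing
  sequence of closed sets. By the parallelogram law their diameters tend to 0, so completeness
  yields a nearest point, and minimality of the distance makes the residual orthogonal.\<close>

lemma closed_subspace_projection:
  fixes R :: "'a::{real_inner, complete_space} set"
  assumes R: "subspace R" "closed R"
  obtains p where "p \<in> R" "\<And>v. v \<in> R \<Longrightarrow> (x - p) \<bullet> v = 0"
proof -
  define d where "d = (INF q\<in>R. (norm (x - q))\<^sup>2)"
  have bdd: "bdd_below ((\<lambda>q. (norm (x - q))\<^sup>2) ` R)" by (intro bdd_belowI[of _ 0]) auto
  have ne: "R \<noteq> {}" using R(1) subspace_0 by blast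
  have dle: "d \<le> (norm (x - q))\<^sup>2" if "q \<in> R" for q
    unfolding d_def by (rule cINF_lower[OF bdd that])
  define S where "S n = {q \<in> R. (norm (x - q))\<^sup>2 \<le> d + inverse (of_nat (Suc n))}" for n
  have clS: "closed (S n)" for n
  proof -
    have "S n = R \<inter> {q. (norm (x - q))\<^sup>2 \<le> d + inverse (of_nat (Suc n))}" by (auto simp: S_def)
    then show ?thesis
      by (auto intro!: closed_Int R(2) closed_Collect_le continuous_intros)
  qed
  have neS: "S n \<noteq> {}" for n
  proof -
    have "\<exists>q\<in>R. (norm (x - q))\<^sup>2 < d + inverse (of_nat (Suc n))"
      using cINF_less_iff[OF ne bdd, of "d + inverse (of_nat (Suc n))"] unfolding d_def[symmetric]
      by simp
    then show ?thesis unfolding S_def by force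
  qed
  have dec: "S n \<subseteq> S m" if "m \<le> n" for m n
  proof -
    have "inverse (real (Suc n)) \<le> inverse (real (Suc m))" using that by (intro le_imp_inverse_le) auto
    then have "d + inverse (real (Suc n)) \<le> d + inverse (real (Suc m))" by (rule add_left_mono)
    then show ?thesis unfolding S_def by (blast intro: order_trans)
  qed
  have small: "\<exists>n. \<forall>p\<in>S n. \<forall>q\<in>S n. dist p q < e" if "e > 0" for e
  proof -
    have "0 < e\<^sup>2 / 4" using that by simp
    then obtain n where n: "inverse (of_nat (Suc n)) < e\<^sup>2 / 4"
      using reals_Archimedean by blast
    have "dist p q < e" if pq: "p \<in> S n" "q \<in> S n" for p q
    proof -
      have "(1/2) *\<^sub>R (p + q) \<in> R"
        using pq R(1) by (auto simp: S_def intro!: subspace_scale subspace_add)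
      note dle[OF this]
      moreover have "(norm (p - q))\<^sup>2 = 2 * (norm (x - p))\<^sup>2 + 2 * (norm (x - q))\<^sup>2
          - 4 * (norm (x - (1/2) *\<^sub>R (p + q)))\<^sup>2"
        by (simp add: power2_norm_eq_inner inner_simps inner_commute algebra_simps)
      ultimately have "(norm (p - q))\<^sup>2 < e\<^sup>2" using pq n by (simp add: S_def)
      then show ?thesis using \<open>e > 0\<close> by (simp add: dist_norm power_less_imp_less_base)
    qed
    then show ?thesis by blast
  qed
  obtain p where p: "\<And>n. p \<in> S n" using decreasing_closed_nest[of S] clS neS dec small by blast
  have pR: "p \<in> R" using p by (auto simp: S_def)
  have "(norm (x - p))\<^sup>2 - d \<le> 0"
  proof (rule field_le_epsilon)
    fix e :: real assume "e > 0"
    then obtain n where "inverse (of_nat (Suc n)) < e" using reals_Archimedean by blast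
    then show "(norm (x - p))\<^sup>2 - d \<le> 0 + e" using p[of n] by (simp add: S_def)
  qed
  then have min: "(norm (x - p))\<^sup>2 \<le> (norm (x - q))\<^sup>2" if "q \<in> R" for q
    using dle[OF that] by linarith
  have "(x - p) \<bullet> v = 0" if v: "v \<in> R" for v
  proof (cases "v = 0")
    case False
    \<comment> \<open>Moving \<open>p\<close> by this multiple of \<open>v\<close> would lower the distance unless the inner product vanishes.\<close>
    define t where "t = ((x - p) \<bullet> v) / (v \<bullet> v)"
    have "p + t *\<^sub>R v \<in> R" using R(1) pR v by (simp add: subspace_add subspace_scale)
    note min[OF this]
    moreover have "(norm (x - (p + t *\<^sub>R v)))\<^sup>2
        = (norm (x - p))\<^sup>2 - 2 * t * ((x - p) \<bullet> v) + t * (t * (v \<bullet> v))"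
      by (simp add: power2_norm_eq_inner inner_simps inner_commute algebra_simps)
    moreover have "t * (v \<bullet> v) = (x - p) \<bullet> v" using False by (simp add: t_def)
    ultimately have "t * ((x - p) \<bullet> v) \<le> 0" by simp
    moreover have "t * ((x - p) \<bullet> v) = ((x - p) \<bullet> v)\<^sup>2 / (v \<bullet> v)"
      by (simp add: t_def power2_eq_square)
    moreover have "0 < v \<bullet> v" using False by simp
    ultimately have "((x - p) \<bullet> v)\<^sup>2 \<le> 0" by (metis divide_le_0_iff not_less)
    then show ?thesis by simp
  qed simp
  with pR show thesis using that by blast
qed

text \<open>The uniform boundedness principle, for functionals represented by vectors. By the Baire
  category theorem one of the sets on which all functionals are bounded by \<open>m\<close> contains a
  ball, and a bound on a ball bounds the norms.\<close>

lemma pointwise_bounded_imp_bounded: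
  fixes A :: "'a::{real_inner, complete_space} set"
  assumes "\<And>y. bounded ((\<lambda>a. a \<bullet> y) ` A)"
  shows "bounded A"
proof -
  define T where "T m = {y. \<forall>a\<in>A. \<bar>a \<bullet> y\<bar> \<le> real m}" for m
  have T_alt: "T m = (\<Inter>a\<in>A. {y. \<bar>a \<bullet> y\<bar> \<le> real m})" for m by (auto simp: T_def)
  have clT: "closed (T m)" for m unfolding T_alt
    by (intro closed_INT ballI closed_Collect_le continuous_intros)
  have "(\<Union>m. T m) = UNIV"
  proof safe
    fix y
    obtain B where "\<And>a. a \<in> A \<Longrightarrow> \<bar>a \<bullet> y\<bar> \<le> B"
      using assms[of y] by (auto simp: bounded_iff)
    moreover obtain m where "B \<le> real m" using real_arch_simple by blast
    ultimately have "y \<in> T m" unfolding T_def by (auto intro: order_trans)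
    then show "y \<in> (\<Union>m. T m)" by blast
  qed simp
  moreover have "interior (\<Union>m. T m) = {}" if "\<And>m. interior (T m) = {}"
    using Baire_category_alt[of euclidean "range T"] clT that
    by (auto simp: completely_metrizable_space_euclidean)
  ultimately obtain m y where "y \<in> interior (T m)" by fastforce
  then obtain r where r: "r > 0" "ball y r \<subseteq> T m" using mem_interior by blast
  have "norm a \<le> 4 * real m / r" if a: "a \<in> A" for a
  proof (cases "a = 0")
    case False
    define v where "v = (r / (2 * norm a)) *\<^sub>R a"
    have "norm v = r / 2" using False r by (simp add: v_def)
    then have "y \<in> ball y r" "y + v \<in> ball y r" using r by (auto simp: dist_norm)
    then have "\<bar>a \<bullet> y\<bar> \<le> real m" "\<bar>a \<bullet> (y + v)\<bar> \<le> real m"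
      using r(2) a unfolding T_def by blast+
    then have "a \<bullet> v \<le> 2 * real m" by (simp add: inner_add_right)
    moreover have "a \<bullet> v = (r / 2) * norm a"
      using False by (simp add: v_def power2_norm_eq_inner[symmetric] power2_eq_square)
    ultimately show ?thesis using r(1) by (simp add: field_simps)
  qed (use r in simp)
  then show ?thesis by (auto simp: bounded_iff)
qed

text \<open>For a self-adjoint operator the kernel is the orthogonal complement of the range, so the
  space is the sum of the closed range and the kernel. If \<open>L u\<close> is small then pairing \<open>u\<close> with an
  element \<open>L w\<close> of the range gives \<open>L u \<bullet> w\<close>, which is small too. Hence the vectors
  \<open>u\<close> orthogonal to the kernel with \<open>norm (L u) \<le> 1\<close> are pointwise bounded.\<close>

lemma self_adjoint_closed_range_bounded_below:
  fixes L :: "'a::{real_inner, complete_space} \<Rightarrow> 'a"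
  assumes L: "bounded_linear L" "self_adjoint L" "closed (range L)"
  obtains c where "c > 0"
    "\<And>u. (\<And>k. L k = 0 \<Longrightarrow> u \<bullet> k = 0) \<Longrightarrow> norm u \<le> c * norm (L u)"
proof -
  interpret L: bounded_linear L by fact
  define A where "A = {u. (\<forall>k. L k = 0 \<longrightarrow> u \<bullet> k = 0) \<and> norm (L u) \<le> 1}"
  have sa: "L x \<bullet> y = x \<bullet> L y" for x y using L(2) by (auto simp: self_adjoint_def)
  have "bounded ((\<lambda>u. u \<bullet> y) ` A)" for y
  proof -
    \<comment> \<open>The component of \<open>y\<close> orthogonal to the range lies in the kernel, so \<open>A\<close> does not see it.\<close>
    have "subspace (range L)"
      by (simp add: L.linear linear_subspace_image subspace_UNIV)
    then obtain p where p: "p \<in> range L" "\<And>v. v \<in> range L \<Longrightarrow> (y - p) \<bullet> v = 0"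
      using closed_subspace_projection[of "range L" y] L(3) by blast
    obtain w where w: "p = L w" using p(1) by auto
    have "L (y - p) \<bullet> L (y - p) = 0" using p(2) by (metis rangeI sa)
    then have ker: "L (y - p) = 0" by simp
    have "\<bar>u \<bullet> y\<bar> \<le> norm w" if u: "u \<in> A" for u
    proof -
      have "u \<bullet> y = u \<bullet> (y - p) + u \<bullet> p" by (simp add: inner_diff_right)
      also have "\<dots> = L u \<bullet> w" using u ker by (simp add: A_def w sa)
      finally have "\<bar>u \<bullet> y\<bar> \<le> norm (L u) * norm w" by (simp add: Cauchy_Schwarz_ineq2)
      also have "\<dots> \<le> 1 * norm w" using u by (intro mult_right_mono) (auto simp: A_def)
      finally show ?thesis by simp
    qed
    then show ?thesis by (auto simp: bounded_iff)
  qed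
  then have "bounded A" by (rule pointwise_bounded_imp_bounded)
  then obtain c where c: "c > 0" "\<And>u. u \<in> A \<Longrightarrow> norm u \<le> c" unfolding bounded_pos by blast
  have "norm u \<le> c * norm (L u)" if u: "\<And>k. L k = 0 \<Longrightarrow> u \<bullet> k = 0" for u
  proof (cases "L u = 0")
    case True
    then show ?thesis using u[of u] by simp
  next
    case False
    have "(1 / norm (L u)) *\<^sub>R u \<in> A" using u False by (simp add: A_def L.scaleR)
    from c(2)[OF this] show ?thesis using False by (simp add: field_simps)
  qed
  with c(1) show thesis using that by blast
qed

section \<open>Antiderivatives in a Hilbert space\<close>

text \<open>If \<open>f\<close> is not zero, a vector \<open>u\<close> orthogonal to its kernel exists, and every
  \<open>y\<close> differs from a multiple of \<open>u\<close> by an element of the kernel.\<close>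

lemma riesz_representation:
  fixes f :: "'a::{real_inner, complete_space} \<Rightarrow> real"
  assumes "bounded_linear f"
  obtains w where "\<And>y. f y = w \<bullet> y"
proof (cases "\<forall>x. f x = 0")
  case True
  then show ?thesis using that[of 0] by simp
next
  case False
  interpret f: bounded_linear f by fact
  obtain x where x: "f x \<noteq> 0" using False by blast
  have "subspace {y. f y = 0}"
    by (auto simp: subspace_def f.add f.scaleR)
  moreover have "closed {y. f y = 0}"
    by (intro closed_Collect_eq linear_continuous_on[OF assms] continuous_on_const)
  ultimately obtain p where "p \<in> {y. f y = 0}" "\<And>v. v \<in> {y. f y = 0} \<Longrightarrow> (x - p) \<bullet> v = 0"
    using closed_subspace_projection[of "{y. f y = 0}" x] by blast
  then have p: "f p = 0" "\<And>v. f v = 0 \<Longrightarrow> (x - p) \<bullet> v = 0" by simp_all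
  define u where "u = x - p"
  have fu: "f u = f x" using p(1) by (simp add: u_def f.diff)
  then have "u \<noteq> 0" using x f.zero by auto
  then have uu: "u \<bullet> u \<noteq> 0" by simp
  have "f y = ((f u / (u \<bullet> u)) *\<^sub>R u) \<bullet> y" for y
  proof -
    have "f (y - (f y / f u) *\<^sub>R u) = 0" using fu x by (simp add: f.diff f.scaleR)
    then have "u \<bullet> (y - (f y / f u) *\<^sub>R u) = 0" using p(2) by (simp add: u_def)
    then have "u \<bullet> y = (f y / f u) * (u \<bullet> u)" by (simp add: inner_diff_right)
    then show ?thesis using uu fu x by simp
  qed
  then show ?thesis using that by blast
qed

text \<open>The integral is formed in the dual space, whose type belongs to the class \<open>banach\<close> that
  integration requires, and carried back along \<open>x \<mapsto> (\<lambda>y. x \<bullet> y)\<close>, which by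
  the Riesz theorem is an isometry onto the dual.\<close>

lemma continuous_has_antiderivative:
  fixes g :: "real \<Rightarrow> 'a::{real_inner, complete_space}"
  assumes g: "continuous_on {a..b} g"
  shows "\<exists>P. \<forall>t\<in>{a..b}. (P has_vector_derivative g t) (at t within {a..b})"
proof -
  define J :: "'a \<Rightarrow> 'a \<Rightarrow>\<^sub>L real" where "J = blinfun_inner_left"
  have J: "bounded_linear J" unfolding J_def by (rule bounded_linear_blinfun_inner_left)
  interpret J: bounded_linear J by fact
  have normJ: "norm x \<le> norm (J x)" for x
  proof (cases "x = 0")
    case False
    have "norm (blinfun_apply (J x) x) \<le> norm (J x) * norm x" by (rule norm_blinfun)
    then have "norm x * norm x \<le> norm (J x) * norm x"
      by (simp add: J_def dot_square_norm power2_eq_square)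
    then show ?thesis using False by simp
  qed simp
  have "inj J"
  proof (rule injI)
    fix x y assume "J x = J y"
    then have "norm (x - y) \<le> 0" using normJ[of "x - y"] by (simp add: J.diff)
    then show "x = y" by simp
  qed
  have "surj J"
  proof (rule surjI)
    fix f
    show "J (SOME w. J w = f) = f"
    proof (rule someI_ex)
      obtain w where "\<And>y. blinfun_apply f y = w \<bullet> y"
        using riesz_representation[OF blinfun.bounded_linear_right, of f] by blast
      then have "J w = f" by (intro blinfun_eqI) (simp add: J_def inner_commute)
      then show "\<exists>w. J w = f" by blast
    qed
  qed
  define K where "K = inv J"
  have KJ: "K (J x) = x" for x using \<open>inj J\<close> by (simp add: K_def)
  have JK: "J (K f) = f" for f using \<open>surj J\<close> by (simp add: K_def surj_f_inv_f)
  have "bounded_linear K"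
  proof (rule bounded_linear_intro[where K = 1])
    show "K (f + h) = K f + K h" for f h by (metis J.add JK KJ)
    show "K (r *\<^sub>R f) = r *\<^sub>R K f" for r f by (metis J.scaleR JK KJ)
    show "norm (K f) \<le> norm f * 1" for f using normJ[of "K f"] by (simp add: JK)
  qed
  then interpret K: bounded_linear K .
  have "continuous_on {a..b} (\<lambda>s. J (g s))" by (rule J.continuous_on[OF g])
  then have "((\<lambda>u. integral {a..u} (\<lambda>s. J (g s))) has_vector_derivative J (g t)) (at t within {a..b})"
    if "t \<in> {a..b}" for t using that by (rule integral_has_vector_derivative)
  from K.has_vector_derivative[OF this]
  have "((\<lambda>u. K (integral {a..u} (\<lambda>s. J (g s)))) has_vector_derivative g t) (at t within {a..b})"
    if "t \<in> {a..b}" for t using that by (simp add: KJ)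
  then show ?thesis by blast
qed

section \<open>Differential inequalities\<close>

lemma has_vector_derivative_imp_continuous_on:
  "(\<And>t. t \<in> S \<Longrightarrow> (w has_vector_derivative w' t) (at t within S)) \<Longrightarrow> continuous_on S w"
  by (auto simp: continuous_on_eq_continuous_within intro: has_vector_derivative_continuous)

lemma mean_value_vector:
  fixes w :: "real \<Rightarrow> 'a::real_normed_vector"
  assumes S: "convex S" and w: "\<And>t. t \<in> S \<Longrightarrow> (w has_vector_derivative w' t) (at t within S)"
    and B: "\<And>t. t \<in> S \<Longrightarrow> norm (w' t) \<le> B" and st: "s \<in> S" "t \<in> S"
  shows "norm (w s - w t) \<le> B * \<bar>s - t\<bar>"
proof -
  have "norm (w s - w t) \<le> B * norm (s - t)"
  proof (rule differentiable_bound[OF S _ _ st])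
    show "(w has_derivative (\<lambda>x. x *\<^sub>R w' t)) (at t within S)" if "t \<in> S" for t
      using w[OF that] by (simp add: has_vector_derivative_def)
    show "onorm (\<lambda>x. x *\<^sub>R w' t) \<le> B" if "t \<in> S" for t
      using B[OF that] by (simp add: onorm_scaleR_left[OF bounded_linear_ident] onorm_id)
  qed
  then show ?thesis by simp
qed

text \<open>The function \<open>exp (- \<alpha> t) v t - \<beta> t\<close> does not increase.\<close>

lemma gronwall:
  fixes v :: "real \<Rightarrow> real"
  assumes T: "0 \<le> T" and nonneg: "0 \<le> \<alpha>" "0 \<le> \<beta>" and v: "continuous_on {0..T} v"
    and v': "\<And>t. 0 < t \<Longrightarrow> t < T \<Longrightarrow> (v has_real_derivative v' t) (at t)"
    and le: "\<And>t. 0 < t \<Longrightarrow> t < T \<Longrightarrow> v' t \<le> \<alpha> * v t + \<beta>"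
  shows "v T \<le> exp (\<alpha> * T) * (v 0 + \<beta> * T)"
proof -
  define u where "u t = exp (- \<alpha> * t) * v t - \<beta> * t" for t
  have "u T \<le> u 0"
  proof (rule DERIV_nonpos_imp_decreasing_open[OF T])
    show "continuous_on {0..T} u" unfolding u_def by (intro continuous_intros v)
    fix t assume t: "0 < t" "t < T"
    have "(u has_real_derivative (exp (- \<alpha> * t) * (v' t - \<alpha> * v t) - \<beta>)) (at t)"
      unfolding u_def by (rule derivative_eq_intros v'[OF t] refl | simp add: algebra_simps)+
    moreover have "exp (- \<alpha> * t) * (v' t - \<alpha> * v t) \<le> 1 * \<beta>"
    proof -
      have "exp (- \<alpha> * t) * (v' t - \<alpha> * v t) \<le> exp (- \<alpha> * t) * \<beta>"
        using le[OF t] by (intro mult_left_mono) auto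
      also have "\<dots> \<le> 1 * \<beta>" using nonneg t by (intro mult_right_mono) auto
      finally show ?thesis .
    qed
    ultimately show "\<exists>y. (u has_real_derivative y) (at t) \<and> y \<le> 0" by force
  qed
  then have "exp (- \<alpha> * T) * v T \<le> v 0 + \<beta> * T" by (simp add: u_def)
  then have "exp (\<alpha> * T) * (exp (- \<alpha> * T) * v T) \<le> exp (\<alpha> * T) * (v 0 + \<beta> * T)"
    by (intro mult_left_mono) auto
  moreover have "exp (\<alpha> * T) * (exp (- \<alpha> * T) * v T) = v T"
    by (simp add: exp_minus)
  ultimately show ?thesis by argo
qed

lemma norm_squared_has_derivative:
  fixes w :: "real \<Rightarrow> 'a::real_inner"
  assumes "(w has_vector_derivative w') (at t within S)"
  shows "((\<lambda>t. (norm (w t))\<^sup>2) has_real_derivative 2 * (w t \<bullet> w')) (at t within S)"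
proof -
  have "((\<lambda>t. w t \<bullet> w t) has_vector_derivative w t \<bullet> w' + w' \<bullet> w t) (at t within S)"
    by (rule bounded_bilinear.has_vector_derivative[OF bounded_bilinear_inner assms assms])
  then show ?thesis
    by (simp add: has_real_derivative_iff_has_vector_derivative power2_norm_eq_inner inner_commute)
qed

text \<open>Working with the square of the norm avoids the points where the norm is not differentiable. The
  mixed term is absorbed by \<open>2 b \<bar>w\<bar> \<le> \<bar>w\<bar>^2 + b^2\<close>, whence the
  exponent \<open>2 a + 1\<close>.\<close>

lemma norm_growth_bound:
  fixes w :: "real \<Rightarrow> 'a::real_inner"
  assumes T: "0 \<le> T" and nonneg: "0 \<le> a" "0 \<le> b"
    and w: "\<And>t. t \<in> {0..T} \<Longrightarrow> (w has_vector_derivative w' t) (at t within {0..T})"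
    and le: "\<And>t. 0 < t \<Longrightarrow> t < T \<Longrightarrow> norm (w' t) \<le> a * norm (w t) + b"
  shows "(norm (w T))\<^sup>2 \<le> exp ((2 * a + 1) * T) * ((norm (w 0))\<^sup>2 + b\<^sup>2 * T)"
proof (rule gronwall[where v = "\<lambda>t. (norm (w t))\<^sup>2" and v' = "\<lambda>t. 2 * (w t \<bullet> w' t)", OF T])
  show "continuous_on {0..T} (\<lambda>t. (norm (w t))\<^sup>2)"
    by (intro continuous_intros has_vector_derivative_imp_continuous_on[OF w])
  fix t assume t: "0 < t" "t < T"
  have "(w has_vector_derivative w' t) (at t)"
    using w[of t] t by (simp add: at_within_Icc_at)
  then show "((\<lambda>t. (norm (w t))\<^sup>2) has_real_derivative 2 * (w t \<bullet> w' t)) (at t)"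
    by (rule norm_squared_has_derivative)
  have "2 * (w t \<bullet> w' t) \<le> 2 * (norm (w t) * norm (w' t))"
    using norm_cauchy_schwarz[of "w t" "w' t"] by simp
  also have "\<dots> \<le> 2 * (norm (w t) * (a * norm (w t) + b))"
    using le[OF t] by (intro mult_left_mono) auto
  also have "\<dots> \<le> (2 * a + 1) * (norm (w t))\<^sup>2 + b\<^sup>2"
    using sum_squares_bound[of "norm (w t)" b] by (simp add: power2_eq_square algebra_simps)
  finally show "2 * (w t \<bullet> w' t) \<le> (2 * a + 1) * (norm (w t))\<^sup>2 + b\<^sup>2" .
qed (use nonneg in auto)

section \<open>Global flows of locally Lipschitz fields of linear growth\<close>

definition locally_lipschitz :: "('a::real_normed_vector \<Rightarrow> 'a) \<Rightarrow> bool" where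
  "locally_lipschitz G \<longleftrightarrow> (\<forall>x. \<exists>r>0. \<exists>K. K-lipschitz_on (cball x r) G)"

definition solves_on :: "('a::real_normed_vector \<Rightarrow> 'a) \<Rightarrow> (real \<Rightarrow> 'a) \<Rightarrow> real \<Rightarrow> bool" where
  "solves_on G \<sigma> T \<longleftrightarrow> (\<forall>t\<in>{0..T}. (\<sigma> has_vector_derivative G (\<sigma> t)) (at t within {0..T}))"

lemma solves_on_subset: "solves_on G \<sigma> T \<Longrightarrow> S \<le> T \<Longrightarrow> solves_on G \<sigma> S"
  unfolding solves_on_def by (force intro: has_vector_derivative_within_subset)

text \<open>A locally Lipschitz field need not be Lipschitz on bounded sets of a Hilbert space. It has a
  Lipschitz constant for pairs of nearby points of which one lies in a compact set: cover that set
  by finitely many balls of half the radius on which the field is Lipschitz.\<close>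

lemma lipschitz_near_compact:
  fixes G :: "'a::real_normed_vector \<Rightarrow> 'a"
  assumes G: "locally_lipschitz G" and C: "compact C"
  obtains \<rho> K where "\<rho> > 0" "K \<ge> 0"
    "\<And>x u. x \<in> C \<Longrightarrow> norm (u - x) \<le> \<rho> \<Longrightarrow> norm (G u - G x) \<le> K * norm (u - x)"
proof -
  obtain r k where r: "\<And>x. r x > 0" and k: "\<And>x. (k x)-lipschitz_on (cball x (r x)) G"
    using G unfolding locally_lipschitz_def by metis
  obtain D where D: "D \<subseteq> C" "finite D" "C \<subseteq> (\<Union>x\<in>D. ball x (r x / 2))"
    by (rule compactE_image[OF C, of C "\<lambda>x. ball x (r x / 2)"]) (use r in force)+
  show thesis
  proof (cases "D = {}")
    case True
    then show thesis using that[of 1 0] D by auto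
  next
    case False
    define \<rho> where "\<rho> = Min ((\<lambda>x. r x / 2) ` D)"
    define K where "K = Max (k ` D)"
    have "\<rho> > 0" unfolding \<rho>_def using D False r by auto
    obtain x0 where "x0 \<in> D" using False by blast
    have k0: "k x \<ge> 0" for x using k lipschitz_on_nonneg by blast
    have "0 \<le> k x0" by (rule k0)
    also have "\<dots> \<le> K" unfolding K_def using D \<open>x0 \<in> D\<close> by auto
    finally have "K \<ge> 0" .
    have "norm (G u - G x) \<le> K * norm (u - x)" if x: "x \<in> C" and u: "norm (u - x) \<le> \<rho>" for x u
    proof -
      obtain z where z: "z \<in> D" "dist z x < r z / 2" using D x by auto
      have "\<rho> \<le> r z / 2" unfolding \<rho>_def using D z by (intro Min_le) auto
      then have "dist x u \<le> r z / 2" using u by (simp add: dist_norm norm_minus_commute)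
      then have "x \<in> cball z (r z)" "u \<in> cball z (r z)"
        using z r[of z] dist_triangle[of z u x] by auto
      then have "dist (G u) (G x) \<le> k z * dist u x" using lipschitz_onD[OF k] by blast
      also have "\<dots> \<le> K * dist u x" unfolding K_def using D z by (intro mult_right_mono) auto
      finally show ?thesis by (simp add: dist_norm)
    qed
    with \<open>\<rho> > 0\<close> \<open>K \<ge> 0\<close> show thesis using that by blast
  qed
qed

text \<open>Approximate solutions stay near an exact solution \<open>\<sigma>\<close>. The image of \<open>\<sigma>\<close>
  is compact, so the field has a Lipschitz constant relative to it within some distance \<open>\<rho>\<close>.
  Up to the first time at which the distance reaches \<open>min e \<rho>\<close> the differential inequality
  for the distance is available, and for small \<open>d\<close> it shows that there is no such time.
  The lemma serves twice: it yields uniqueness of solutions, and it passes to the limit in sequences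
  of trajectories of different fields.\<close>

lemma trajectory_perturbation:
  fixes G :: "'a::real_inner \<Rightarrow> 'a"
  assumes G: "locally_lipschitz G" and \<sigma>: "solves_on G \<sigma> T" and e: "e > 0"
  shows "\<exists>d>0. \<forall>\<gamma> g. (\<forall>t\<in>{0..T}. (\<gamma> has_vector_derivative g t) (at t within {0..T})
        \<and> norm (g t - G (\<gamma> t)) \<le> d) \<and> norm (\<gamma> 0 - \<sigma> 0) \<le> d
      \<longrightarrow> (\<forall>t\<in>{0..T}. norm (\<gamma> t - \<sigma> t) < e)"
proof (cases "0 \<le> T")
  case False
  then show ?thesis by (auto intro: exI[of _ 1])
next
  case T: True
  have \<sigma>': "(\<sigma> has_vector_derivative G (\<sigma> t)) (at t within {0..T})" if "t \<in> {0..T}" for t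
    using \<sigma> that by (simp add: solves_on_def)
  have con\<sigma>: "continuous_on {0..T} \<sigma>" using \<sigma>' by (rule has_vector_derivative_imp_continuous_on)
  have "compact (\<sigma> ` {0..T})" using con\<sigma> by (intro compact_continuous_image) auto
  from lipschitz_near_compact[OF G this] obtain \<rho> K where \<rho>: "\<rho> > 0" and K: "K \<ge> 0"
    "\<And>t u. t \<in> {0..T} \<Longrightarrow> norm (u - \<sigma> t) \<le> \<rho> \<Longrightarrow> norm (G u - G (\<sigma> t)) \<le> K * norm (u - \<sigma> t)"
    by (metis imageI)
  define \<epsilon> where "\<epsilon> = min e \<rho>"
  define c where "c = exp ((2 * K + 1) * T) * (1 + T)"
  define d where "d = \<epsilon> / (2 * sqrt c)"
  have c: "c > 0" unfolding c_def using T by (intro mult_pos_pos) auto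
  have \<epsilon>: "\<epsilon> > 0" using e \<rho> by (simp add: \<epsilon>_def)
  have d: "d > 0" using c \<epsilon> by (simp add: d_def)
  have "c * d\<^sup>2 = \<epsilon>\<^sup>2 / 4" using c by (simp add: d_def power_divide power_mult_distrib)
  moreover have "\<epsilon>\<^sup>2 > 0" using \<epsilon> by simp
  ultimately have cd: "c * d\<^sup>2 < \<epsilon>\<^sup>2" by linarith
  have "norm (\<gamma> t - \<sigma> t) < e"
    if \<gamma>: "\<And>t. t \<in> {0..T} \<Longrightarrow> (\<gamma> has_vector_derivative g t) (at t within {0..T})"
      and g: "\<And>t. t \<in> {0..T} \<Longrightarrow> norm (g t - G (\<gamma> t)) \<le> d"
      and init: "norm (\<gamma> 0 - \<sigma> 0) \<le> d" and t: "t \<in> {0..T}" for \<gamma> g t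
  proof (rule ccontr)
    assume "\<not> norm (\<gamma> t - \<sigma> t) < e"
    then have far: "\<epsilon> \<le> norm (\<gamma> t - \<sigma> t)" by (simp add: \<epsilon>_def)
    define A where "A = {s \<in> {0..T}. \<epsilon> \<le> norm (\<gamma> s - \<sigma> s)}"
    have con: "continuous_on {0..T} (\<lambda>s. norm (\<gamma> s - \<sigma> s))"
      by (intro continuous_intros con\<sigma> has_vector_derivative_imp_continuous_on[OF \<gamma>])
    have "closed A" unfolding A_def
      by (rule continuous_on_closed_Collect_le[OF continuous_on_const con closed_atLeastAtMost])
    moreover have "A \<subseteq> {0..T}" by (auto simp: A_def)
    ultimately have "compact A" by (metis compact_Icc compact_Int_closed inf.absorb_iff2)
    moreover have "A \<noteq> {}" using t far by (auto simp: A_def)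
    \<comment> \<open>The first time at which the two curves are far apart.\<close>
    ultimately obtain T' where T': "T' \<in> A" "\<And>s. s \<in> A \<Longrightarrow> T' \<le> s"
      using compact_attains_inf by metis
    have T'T: "0 \<le> T'" "T' \<le> T" using T' by (auto simp: A_def)
    have "(norm (\<gamma> T' - \<sigma> T'))\<^sup>2 \<le> exp ((2 * K + 1) * T') * ((norm (\<gamma> 0 - \<sigma> 0))\<^sup>2 + d\<^sup>2 * T')"
    proof (rule norm_growth_bound[where w' = "\<lambda>s. g s - G (\<sigma> s)"])
      show "0 \<le> T'" "0 \<le> K" "0 \<le> d" using T'T K d by auto
      show "((\<lambda>s. \<gamma> s - \<sigma> s) has_vector_derivative g s - G (\<sigma> s)) (at s within {0..T'})"
        if "s \<in> {0..T'}" for s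
        using \<gamma>[of s] \<sigma>'[of s] T'T that
        by (intro has_vector_derivative_diff)
           (auto elim: has_vector_derivative_within_subset)
      fix s assume s: "0 < s" "s < T'"
      then have "s \<notin> A" using T'(2) by force
      then have "norm (\<gamma> s - \<sigma> s) \<le> \<rho>" using s T'T by (auto simp: A_def \<epsilon>_def)
      then have "norm (G (\<gamma> s) - G (\<sigma> s)) \<le> K * norm (\<gamma> s - \<sigma> s)" using K s T'T by auto
      moreover have "norm (g s - G (\<gamma> s)) \<le> d" using g s T'T by auto
      ultimately show "norm (g s - G (\<sigma> s)) \<le> K * norm (\<gamma> s - \<sigma> s) + d"
        using norm_triangle_ineq[of "g s - G (\<gamma> s)" "G (\<gamma> s) - G (\<sigma> s)"] by simp
    qed
    also have "\<dots> \<le> exp ((2 * K + 1) * T) * (d\<^sup>2 + d\<^sup>2 * T)"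
      using init K T'T d by (intro mult_mono add_mono mult_left_mono power_mono) auto
    also have "\<dots> = c * d\<^sup>2" by (simp add: c_def algebra_simps)
    also note cd
    finally have "norm (\<gamma> T' - \<sigma> T') < \<epsilon>" using \<epsilon> by (simp add: power_less_imp_less_base)
    then show False using T'(1) by (simp add: A_def)
  qed
  with d show ?thesis by blast
qed

lemma solves_on_unique:
  fixes G :: "'a::real_inner \<Rightarrow> 'a"
  assumes G: "locally_lipschitz G" and \<sigma>: "solves_on G \<sigma> T" and \<gamma>: "solves_on G \<gamma> T"
    and init: "\<gamma> 0 = \<sigma> 0" and t: "t \<in> {0..T}"
  shows "\<gamma> t = \<sigma> t"
proof -
  have "norm (\<gamma> t - \<sigma> t) < e" if "e > 0" for e
  proof -
    obtain d where d: "d > 0"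
      "\<And>\<gamma> g. (\<forall>t\<in>{0..T}. (\<gamma> has_vector_derivative g t) (at t within {0..T})
        \<and> norm (g t - G (\<gamma> t)) \<le> d) \<and> norm (\<gamma> 0 - \<sigma> 0) \<le> d
      \<Longrightarrow> \<forall>t\<in>{0..T}. norm (\<gamma> t - \<sigma> t) < e"
      using trajectory_perturbation[OF G \<sigma> \<open>e > 0\<close>] by blast
    have "\<forall>t\<in>{0..T}. norm (\<gamma> t - \<sigma> t) < e"
      by (rule d(2)[of \<gamma> "\<lambda>t. G (\<gamma> t)"]) (use \<gamma> init d(1) in \<open>simp add: solves_on_def\<close>)
    then show ?thesis using t by blast
  qed
  from this[of "norm (\<gamma> t - \<sigma> t)"] show ?thesis by auto
qed

text \<open>The Picard iteration contracts the space of continuous curves in a ball around \<open>y\<close>. The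
  curves are defined on the whole line, as bounded continuous functions form a complete metric
  space there, and \<open>c\<close> clamps the time to \<open>{0..\<tau>}\<close>. That \<open>\<tau>\<close> is the same for
  all \<open>y\<close> near \<open>x\<close> is what makes the continuation of solutions possible.\<close>

lemma local_existence:
  fixes G :: "'a::{real_inner, complete_space} \<Rightarrow> 'a"
  assumes "locally_lipschitz G"
  shows "\<exists>\<rho>>0. \<exists>\<tau>>0. \<forall>y. dist x y < \<rho> \<longrightarrow> (\<exists>\<sigma>. \<sigma> 0 = y \<and> solves_on G \<sigma> \<tau>)"
proof -
  obtain r K where r: "r > 0" and lip: "K-lipschitz_on (cball x r) G"
    using assms unfolding locally_lipschitz_def by blast
  have K: "K \<ge> 0" using lip by (rule lipschitz_on_nonneg)
  define M where "M = norm (G x) + K * r + 1"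
  have M: "M > 0" using K r unfolding M_def by (intro add_nonneg_pos add_nonneg_nonneg) auto
  have GM: "norm (G u) \<le> M" if u: "u \<in> cball x r" for u
  proof -
    have "dist (G u) (G x) \<le> K * dist u x" using lipschitz_onD[OF lip u] r by simp
    also have "\<dots> \<le> K * r" using K u by (intro mult_left_mono) (auto simp: dist_commute)
    finally have "norm (G u - G x) \<le> K * r" by (simp add: dist_norm)
    then show ?thesis using norm_triangle_ineq[of "G u - G x" "G x"] by (simp add: M_def)
  qed
  define \<tau> where "\<tau> = min (r / (2 * M)) (1 / (2 * (K + 1)))"
  have \<tau>: "\<tau> > 0" using r M K by (simp add: \<tau>_def)
  have "\<tau> \<le> r / (2 * M)" by (simp add: \<tau>_def)
  then have M\<tau>: "M * \<tau> \<le> r / 2" using M by (simp add: field_simps)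
  have "\<tau> \<le> 1 / (2 * (K + 1))" by (simp add: \<tau>_def)
  then have "(K + 1) * \<tau> \<le> 1 / 2" using K by (simp add: field_simps)
  then have K\<tau>: "K * \<tau> \<le> 1 / 2" using \<tau> by (simp add: algebra_simps)
  have "\<exists>\<sigma>. \<sigma> 0 = y \<and> solves_on G \<sigma> \<tau>" if y: "dist x y < r / 2" for y
  proof -
    have sub: "cball y (r / 2) \<subseteq> cball x r"
    proof
      fix u assume "u \<in> cball y (r / 2)"
      then show "u \<in> cball x r" using y dist_triangle[of x u y] by simp
    qed
    define S where "S = PiC UNIV (\<lambda>_::real. cball y (r / 2))"
    have SI: "f \<in> S \<longleftrightarrow> (\<forall>t. apply_bcontfun f t \<in> cball y (r / 2))" for f
      by (auto simp: S_def mem_PiC_iff)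
    have "complete S" unfolding S_def complete_eq_closed by (intro closed_PiC) auto
    have "const_bcontfun y \<in> S" unfolding SI using r by (simp add: const_bcontfun.rep_eq)
    then have "S \<noteq> {}" by blast
    define P where "P f = (SOME P. \<forall>t\<in>{0..\<tau>}.
      (P has_vector_derivative G (apply_bcontfun f t)) (at t within {0..\<tau>}))" for f :: "real \<Rightarrow>\<^sub>C 'a"
    have P: "(P f has_vector_derivative G (apply_bcontfun f t)) (at t within {0..\<tau>})"
      if f: "f \<in> S" and t: "t \<in> {0..\<tau>}" for f t
    proof -
      have "apply_bcontfun f ` {0..\<tau>} \<subseteq> cball x r" using f sub unfolding SI by blast
      then have "continuous_on {0..\<tau>} (\<lambda>t. G (apply_bcontfun f t))"
        by (intro continuous_on_compose2[OF lipschitz_on_continuous_on[OF lip]]) auto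
      then have "\<forall>t\<in>{0..\<tau>}. (P f has_vector_derivative G (apply_bcontfun f t)) (at t within {0..\<tau>})"
        unfolding P_def by (rule someI_ex[OF continuous_has_antiderivative])
      then show ?thesis using t by blast
    qed
    define c where "c t = max 0 (min \<tau> t)" for t :: real
    have c: "c t \<in> {0..\<tau>}" for t using \<tau> by (auto simp: c_def)
    have c0: "\<bar>c t - 0\<bar> \<le> \<tau>" for t using \<tau> by (auto simp: c_def)
    have zero: "0 \<in> {0..\<tau>}" using \<tau> by simp
    define h where "h f t = y + (P f (c t) - P f 0)" for f t
    have h_near: "h f t \<in> cball y (r / 2)" if f: "f \<in> S" for f t
    proof -
      have "norm (P f (c t) - P f 0) \<le> M * \<bar>c t - 0\<bar>"
      proof (rule mean_value_vector[OF _ P[OF f] _ c zero])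
        show "norm (G (apply_bcontfun f s)) \<le> M" for s
          using f sub unfolding SI by (intro GM) blast
      qed auto
      also have "\<dots> \<le> M * \<tau>" using M c0 by (intro mult_left_mono) auto
      also note M\<tau>
      finally show ?thesis by (simp add: h_def dist_norm norm_minus_commute)
    qed
    have hb: "h f \<in> bcontfun" if f: "f \<in> S" for f
    proof -
      have "continuous_on {0..\<tau>} (P f)"
        by (rule has_vector_derivative_imp_continuous_on[OF P[OF f]])
      moreover have "continuous_on UNIV c" unfolding c_def by (intro continuous_intros)
      moreover have "c ` UNIV \<subseteq> {0..\<tau>}" using c by blast
      ultimately have "continuous_on UNIV (\<lambda>t. P f (c t))" by (rule continuous_on_compose2)
      then have "continuous_on UNIV (h f)" unfolding h_def by (intro continuous_intros)
      moreover have "range (h f) \<subseteq> cball y (r / 2)" using h_near[OF f] by blast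
      ultimately show ?thesis unfolding bcontfun_def
        using bounded_subset[OF bounded_cball] by blast
    qed
    have app: "apply_bcontfun (Bcontfun (h f)) = h f" if "f \<in> S" for f
      using hb[OF that] by (rule Bcontfun_inverse)
    have "\<exists>!f\<in>S. Bcontfun (h f) = f"
    proof (rule Banach_fix[OF \<open>complete S\<close> \<open>S \<noteq> {}\<close>, of "1/2"])
      show "(\<lambda>f. Bcontfun (h f)) ` S \<subseteq> S"
      proof
        fix u assume "u \<in> (\<lambda>f. Bcontfun (h f)) ` S"
        then obtain f where f: "f \<in> S" "u = Bcontfun (h f)" by blast
        show "u \<in> S" unfolding SI f(2) app[OF f(1)] using h_near[OF f(1)] by blast
      qed
      fix f f' assume f: "f \<in> S" "f' \<in> S"
      show "dist (Bcontfun (h f)) (Bcontfun (h f')) \<le> 1/2 * dist f f'"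
      proof (rule dist_bound)
        fix t
        have "norm ((P f (c t) - P f' (c t)) - (P f 0 - P f' 0)) \<le> (K * dist f f') * \<bar>c t - 0\<bar>"
        proof (rule mean_value_vector[OF _ has_vector_derivative_diff[OF P[OF f(1)] P[OF f(2)]] _ c zero])
          fix s assume "s \<in> {0..\<tau>}"
          have "dist (G (apply_bcontfun f s)) (G (apply_bcontfun f' s))
              \<le> K * dist (apply_bcontfun f s) (apply_bcontfun f' s)"
            using f sub unfolding SI by (intro lipschitz_onD[OF lip]) blast+
          also have "\<dots> \<le> K * dist f f'" using K by (intro mult_left_mono dist_bounded)
          finally show "norm (G (apply_bcontfun f s) - G (apply_bcontfun f' s)) \<le> K * dist f f'"
            by (simp add: dist_norm)
        qed auto
        also have "\<dots> \<le> (K * dist f f') * \<tau>" using K c0 by (intro mult_left_mono) auto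
        also have "\<dots> = (K * \<tau>) * dist f f'" by simp
        also have "\<dots> \<le> 1/2 * dist f f'" using K\<tau> by (intro mult_right_mono) auto
        finally show "dist (apply_bcontfun (Bcontfun (h f)) t) (apply_bcontfun (Bcontfun (h f')) t)
            \<le> 1/2 * dist f f'"
          unfolding app[OF f(1)] app[OF f(2)] h_def by (simp add: dist_norm algebra_simps)
      qed
    qed auto
    then obtain f where f: "f \<in> S" "Bcontfun (h f) = f" by blast
    then have fh: "apply_bcontfun f = h f" using app by metis
    have ct: "c t = t" if "t \<in> {0..\<tau>}" for t using that by (auto simp: c_def)
    have "h f 0 = y" using \<tau> by (simp add: h_def c_def)
    moreover have "solves_on G (h f) \<tau>" unfolding solves_on_def
    proof
      fix t assume t: "t \<in> {0..\<tau>}"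
      have "((\<lambda>t. y + (P f t - P f 0)) has_vector_derivative G (h f t)) (at t within {0..\<tau>})"
        using P[OF f(1) t] by (auto intro!: derivative_eq_intros simp: fh)
      then show "(h f has_vector_derivative G (h f t)) (at t within {0..\<tau>})"
        by (rule has_vector_derivative_transform[OF t, rotated]) (simp add: h_def ct)
    qed
    ultimately show ?thesis by blast
  qed
  then show ?thesis using r \<tau> by (intro exI[of _ "r / 2"] exI[of _ \<tau>] conjI allI impI) auto
qed

lemma solves_on_concat:
  assumes T: "0 \<le> T" "0 \<le> \<tau>" and \<sigma>: "solves_on G \<sigma> T" and \<sigma>': "solves_on G \<sigma>' \<tau>"
    and joint: "\<sigma>' 0 = \<sigma> T"
  shows "solves_on G (\<lambda>t. if t \<in> {0..T} then \<sigma> t else \<sigma>' (t - T)) (T + \<tau>)"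
  unfolding solves_on_def
proof
  let ?S = "{0..T}" and ?S' = "{T..T + \<tau>}"
  fix t assume t: "t \<in> {0..T + \<tau>}"
  have cl: "closure ?S = ?S" "closure ?S' = ?S'" by simp_all
  have meet: "?S \<inter> ?S' = {T}" using T by auto
  have shift: "((\<lambda>t. \<sigma>' (t - T)) has_vector_derivative G (\<sigma>' (s - T))) (at s within ?S')"
    if s: "s \<in> ?S'" for s
  proof -
    have "((\<lambda>t. t - T) has_vector_derivative 1) (at s within ?S')"
      by (auto intro!: derivative_eq_intros)
    moreover have "(\<lambda>t. t - T) ` ?S' = {0..\<tau>}"
      by (auto simp: image_iff intro!: bexI[of _ "_ + T"])
    then have "(\<sigma>' has_vector_derivative G (\<sigma>' (s - T))) (at (s - T) within (\<lambda>t. t - T) ` ?S')"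
      using \<sigma>' s by (auto simp: solves_on_def)
    ultimately have "((\<sigma>' \<circ> (\<lambda>t. t - T)) has_vector_derivative 1 *\<^sub>R G (\<sigma>' (s - T))) (at s within ?S')"
      by (rule vector_diff_chain_within)
    then show ?thesis by (simp add: o_def)
  qed
  have "((\<lambda>t. if t \<in> ?S then \<sigma> t else \<sigma>' (t - T)) has_vector_derivative
      (if t \<in> ?S then G (\<sigma> t) else G (\<sigma>' (t - T)))) (at t within {0..T + \<tau>})"
  proof (rule has_vector_derivative_If_within_closures[where T = ?S'])
    show "t \<in> ?S \<union> ?S'" "{0..T + \<tau>} = ?S \<union> ?S'" using t T by auto
    show "(\<sigma> has_vector_derivative G (\<sigma> t)) (at t within ?S \<union> closure ?S \<inter> closure ?S')"
      if "t \<in> ?S \<union> closure ?S \<inter> closure ?S'"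
    proof -
      have "?S \<union> closure ?S \<inter> closure ?S' = ?S" unfolding cl by blast
      then show ?thesis using that \<sigma> by (simp add: solves_on_def)
    qed
    show "((\<lambda>t. \<sigma>' (t - T)) has_vector_derivative G (\<sigma>' (t - T))) (at t within ?S' \<union> closure ?S \<inter> closure ?S')"
      if "t \<in> ?S' \<union> closure ?S \<inter> closure ?S'"
    proof -
      have "?S' \<union> closure ?S \<inter> closure ?S' = ?S'" unfolding cl by blast
      then show ?thesis using that shift by simp
    qed
    assume "t \<in> closure ?S" "t \<in> closure ?S'"
    then have "t = T" by simp
    then show "\<sigma> t = \<sigma>' (t - T)" "G (\<sigma> t) = G (\<sigma>' (t - T))" using joint by simp_all
  qed
  then show "((\<lambda>t. if t \<in> ?S then \<sigma> t else \<sigma>' (t - T)) has_vector_derivative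
      G (if t \<in> ?S then \<sigma> t else \<sigma>' (t - T))) (at t within {0..T + \<tau>})"
    by (simp add: if_distrib[of G] cong: if_cong)
qed

text \<open>Otherwise the durations of solutions starting at \<open>x\<close> have a supremum \<open>B\<close>. Linear
  growth bounds the speed of all these solutions, so the end points of solutions whose durations
  tend to \<open>B\<close> form a Cauchy sequence. Near its limit the duration of local solutions is
  bounded below, so one of the solutions can be prolonged beyond \<open>B\<close>.\<close>

lemma solution_for_any_duration:
  fixes G :: "'a::{real_inner, complete_space} \<Rightarrow> 'a"
  assumes G: "locally_lipschitz G" and nonneg: "0 \<le> a" "0 \<le> b"
    and growth: "\<And>x. norm (G x) \<le> a * norm x + b"
  shows "\<exists>\<sigma>. \<sigma> 0 = x \<and> solves_on G \<sigma> T"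
proof (rule ccontr)
  assume none: "\<nexists>\<sigma>. \<sigma> 0 = x \<and> solves_on G \<sigma> T"
  define S where "S = {t. 0 \<le> t \<and> (\<exists>\<sigma>. \<sigma> 0 = x \<and> solves_on G \<sigma> t)}"
  obtain \<sigma>0 \<tau>0 where "\<sigma>0 0 = x" "solves_on G \<sigma>0 \<tau>0" "\<tau>0 > 0"
    using local_existence[OF G, of x] by (metis dist_self)
  then have "\<exists>\<sigma>. \<sigma> 0 = x \<and> solves_on G \<sigma> 0"
    using solves_on_subset[of G \<sigma>0 \<tau>0 0] by auto
  then have "0 \<in> S" unfolding S_def by simp
  have bound: "t \<le> T" if t: "t \<in> S" for t
  proof (rule ccontr)
    assume "\<not> t \<le> T"
    moreover obtain \<sigma> where "\<sigma> 0 = x" "solves_on G \<sigma> t" using t by (auto simp: S_def)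
    ultimately show False using none solves_on_subset[of G \<sigma> t T] by auto
  qed
  define B where "B = Sup S"
  have bdd: "bdd_above S" by (rule bdd_aboveI[OF bound])
  have SB: "t \<le> B" if "t \<in> S" for t unfolding B_def by (rule cSup_upper[OF that bdd])
  have "0 \<le> B" using SB[OF \<open>0 \<in> S\<close>] .
  \<comment> \<open>The linear growth keeps all solutions in one ball, so their speed is bounded.\<close>
  define R where "R = sqrt (exp ((2 * a + 1) * B) * ((norm x)\<^sup>2 + b\<^sup>2 * B))"
  define M where "M = a * R + b"
  have speed: "norm (G (\<sigma> s)) \<le> M" if \<sigma>: "\<sigma> 0 = x" "solves_on G \<sigma> t" "t \<in> S" "s \<in> {0..t}" for \<sigma> t s
  proof -
    have s: "0 \<le> s" "s \<le> B" using \<sigma>(4) SB[OF \<sigma>(3)] by auto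
    have "solves_on G \<sigma> s" using solves_on_subset[OF \<sigma>(2)] \<sigma>(4) by auto
    then have "(norm (\<sigma> s))\<^sup>2 \<le> exp ((2 * a + 1) * s) * ((norm (\<sigma> 0))\<^sup>2 + b\<^sup>2 * s)"
      using s nonneg growth
      by (intro norm_growth_bound[where w' = "\<lambda>t. G (\<sigma> t)"]) (auto simp: solves_on_def)
    also have "\<dots> \<le> exp ((2 * a + 1) * B) * ((norm x)\<^sup>2 + b\<^sup>2 * B)"
      using s nonneg \<sigma>(1) by (intro mult_mono add_mono mult_left_mono) auto
    finally have "norm (\<sigma> s) \<le> R" unfolding R_def by (rule real_le_rsqrt)
    then have "a * norm (\<sigma> s) + b \<le> M" unfolding M_def using nonneg by (intro add_right_mono mult_left_mono)
    then show ?thesis using growth[of "\<sigma> s"] by linarith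
  qed
  have "M \<ge> 0" unfolding M_def R_def using nonneg \<open>0 \<le> B\<close> by simp
  define c where "c t = (SOME \<sigma>. \<sigma> 0 = x \<and> solves_on G \<sigma> t)" for t
  have c: "c t 0 = x" "solves_on G (c t) t" if "t \<in> S" for t
    using someI_ex[of "\<lambda>\<sigma>. \<sigma> 0 = x \<and> solves_on G \<sigma> t"] that by (simp_all add: S_def c_def)
  have ends: "norm (c t t - c s s) \<le> M * \<bar>t - s\<bar>" if st: "s \<in> S" "t \<in> S" "s \<le> t" for s t
  proof -
    have "0 \<le> s" using st by (simp add: S_def)
    have "c t s = c s s"
      by (rule solves_on_unique[OF G c(2)[OF st(1)] solves_on_subset[OF c(2)[OF st(2)] st(3)]])
         (use st c \<open>0 \<le> s\<close> in auto)
    moreover have "norm (c t t - c t s) \<le> M * \<bar>t - s\<bar>"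
      by (rule mean_value_vector[where S = "{0..t}" and w' = "\<lambda>u. G (c t u)"])
         (use c[OF st(2)] speed[OF c[OF st(2)] st(2)] st \<open>0 \<le> s\<close> in \<open>auto simp: solves_on_def\<close>)
    ultimately show ?thesis by simp
  qed
  have "\<exists>t\<in>S. B - inverse (real (Suc n)) < t" for n
    using less_cSupD[of S "B - inverse (real (Suc n))"] \<open>0 \<in> S\<close> unfolding B_def[symmetric] by force
  then obtain \<theta> where \<theta>: "\<And>n. \<theta> n \<in> S" "\<And>n. B - inverse (real (Suc n)) < \<theta> n" by metis
  have \<theta>B: "\<theta> \<longlonglongrightarrow> B"
  proof (rule tendsto_sandwich[of "\<lambda>n. B - inverse (real (Suc n))" _ _ "\<lambda>_. B"])
    show "(\<lambda>n. B - inverse (real (Suc n))) \<longlonglongrightarrow> B"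
      using tendsto_diff[OF tendsto_const LIMSEQ_inverse_real_of_nat, of B] by simp
    show "\<forall>\<^sub>F n in sequentially. B - inverse (real (Suc n)) \<le> \<theta> n"
      by (intro always_eventually allI less_imp_le \<theta>(2))
    show "\<forall>\<^sub>F n in sequentially. \<theta> n \<le> B" by (intro always_eventually allI SB \<theta>(1))
  qed simp
  have dist_ends: "dist (c s s) (c t t) \<le> M * dist s t" if "s \<in> S" "t \<in> S" for s t
    using ends[of s t] ends[of t s] that
    by (cases "s \<le> t") (auto simp: dist_norm norm_minus_commute abs_minus_commute)
  have "Cauchy (\<lambda>n. c (\<theta> n) (\<theta> n))"
  proof (rule metric_CauchyI)
    fix e :: real assume e: "e > 0"
    have "Cauchy \<theta>" using \<theta>B by (rule LIMSEQ_imp_Cauchy)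
    moreover have "0 < e / (M + 1)" using e \<open>M \<ge> 0\<close> by simp
    ultimately obtain N where N: "\<And>m n. m \<ge> N \<Longrightarrow> n \<ge> N \<Longrightarrow> dist (\<theta> m) (\<theta> n) < e / (M + 1)"
      using metric_CauchyD by blast
    have "dist (c (\<theta> m) (\<theta> m)) (c (\<theta> n) (\<theta> n)) < e" if "m \<ge> N" "n \<ge> N" for m n
    proof -
      have "dist (c (\<theta> m) (\<theta> m)) (c (\<theta> n) (\<theta> n)) \<le> M * dist (\<theta> m) (\<theta> n)"
        by (rule dist_ends[OF \<theta>(1) \<theta>(1)])
      also have "\<dots> \<le> (M + 1) * dist (\<theta> m) (\<theta> n)" by (intro mult_right_mono) auto
      also have "\<dots> < (M + 1) * (e / (M + 1))"
        using N[OF that] \<open>M \<ge> 0\<close> by (intro mult_strict_left_mono) auto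
      also have "\<dots> = e" using \<open>M \<ge> 0\<close> by simp
      finally show ?thesis .
    qed
    then show "\<exists>N. \<forall>m\<ge>N. \<forall>n\<ge>N. dist (c (\<theta> m) (\<theta> m)) (c (\<theta> n) (\<theta> n)) < e" by blast
  qed
  then obtain y where y: "(\<lambda>n. c (\<theta> n) (\<theta> n)) \<longlonglongrightarrow> y"
    using Cauchy_convergent convergent_def by blast
  obtain \<rho> \<tau> where \<rho>\<tau>: "\<rho> > 0" "\<tau> > 0"
    "\<And>z. dist y z < \<rho> \<Longrightarrow> \<exists>\<sigma>. \<sigma> 0 = z \<and> solves_on G \<sigma> \<tau>"
    using local_existence[OF G, of y] by blast
  have "\<forall>\<^sub>F n in sequentially. dist (c (\<theta> n) (\<theta> n)) y < \<rho> \<and> B - \<tau> < \<theta> n"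
    using tendstoD[OF y \<rho>\<tau>(1)] order_tendstoD(1)[OF \<theta>B, of "B - \<tau>"] \<rho>\<tau>(2)
    by (intro eventually_conj) auto
  then obtain n where n: "dist (c (\<theta> n) (\<theta> n)) y < \<rho>" "B - \<tau> < \<theta> n"
    using eventually_happens by fastforce
  \<comment> \<open>Restarting close to the limit point overshoots the supremum.\<close>
  obtain \<sigma> where \<sigma>: "\<sigma> 0 = c (\<theta> n) (\<theta> n)" "solves_on G \<sigma> \<tau>"
    using \<rho>\<tau>(3) n(1) by (metis dist_commute)
  have \<theta>n: "0 \<le> \<theta> n" using \<theta>(1)[of n] by (simp add: S_def)
  have "solves_on G (\<lambda>t. if t \<in> {0..\<theta> n} then c (\<theta> n) t else \<sigma> (t - \<theta> n)) (\<theta> n + \<tau>)"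
    by (rule solves_on_concat[OF \<theta>n _ c(2)[OF \<theta>(1)] \<sigma>(2,1)]) (use \<rho>\<tau> in simp)
  moreover have "(if 0 \<in> {0..\<theta> n} then c (\<theta> n) 0 else \<sigma> (0 - \<theta> n)) = x" using c(1)[OF \<theta>(1)] \<theta>n by simp
  ultimately have "\<exists>\<sigma>. \<sigma> 0 = x \<and> solves_on G \<sigma> (\<theta> n + \<tau>)"
    by (intro exI[of _ "\<lambda>t. if t \<in> {0..\<theta> n} then c (\<theta> n) t else \<sigma> (t - \<theta> n)"]) blast
  then have "\<theta> n + \<tau> \<in> S" unfolding S_def using \<theta>n \<rho>\<tau>(2) by simp
  then show False using SB n(2) by force
qed

text \<open>By uniqueness the solutions of different durations fit together.\<close>

lemma forward_solution:
  fixes G :: "'a::{real_inner, complete_space} \<Rightarrow> 'a"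
  assumes G: "locally_lipschitz G" and nonneg: "0 \<le> a" "0 \<le> b"
    and growth: "\<And>x. norm (G x) \<le> a * norm x + b"
  shows "\<exists>\<sigma>. \<sigma> 0 = x \<and> (\<forall>t\<ge>0. (\<sigma> has_vector_derivative G (\<sigma> t)) (at t within {0..}))"
proof -
  have "\<forall>T. \<exists>\<sigma>. \<sigma> 0 = x \<and> solves_on G \<sigma> T"
    using solution_for_any_duration[OF assms] by blast
  from choice[OF this] obtain c where c: "\<And>T. c T 0 = x" "\<And>T. solves_on G (c T) T" by blast
  define \<sigma> where "\<sigma> t = c t t" for t
  have eq: "\<sigma> t = c T t" if "t \<in> {0..T}" for t T
    using solves_on_unique[OF G solves_on_subset[OF c(2)[of T], of t] c(2)[of t], of t] that
    by (simp add: \<sigma>_def c(1))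
  have "(\<sigma> has_vector_derivative G (\<sigma> t)) (at t within {0..})" if t: "t \<ge> 0" for t
  proof -
    have "t \<in> {0..t + 1}" using t by simp
    have "(\<sigma> has_vector_derivative G (\<sigma> t)) (at t within {0..t + 1})"
      by (rule has_vector_derivative_transform[OF \<open>t \<in> {0..t + 1}\<close> eq])
         (use c(2)[of "t + 1"] eq[OF \<open>t \<in> {0..t + 1}\<close>] t in \<open>auto simp: solves_on_def\<close>)
    moreover have "at t within {0..t + 1} = at t within {0..}"
      by (rule at_within_nhd[of _ "{..<t + 1}"]) auto
    ultimately show ?thesis by simp
  qed
  moreover have "\<sigma> 0 = x" by (simp add: \<sigma>_def c)
  ultimately show ?thesis by blast
qed

lemma locally_lipschitz_minus: "locally_lipschitz G \<Longrightarrow> locally_lipschitz (\<lambda>x. - G x)"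
  by (simp add: locally_lipschitz_def lipschitz_on_minus)

lemma has_vector_derivative_reverse:
  fixes f :: "real \<Rightarrow> 'a::real_normed_vector"
  assumes "(f has_vector_derivative f') (at (- t) within uminus ` S)"
  shows "((\<lambda>s. f (- s)) has_vector_derivative - f') (at t within S)"
proof -
  have "((\<lambda>s::real. - s) has_vector_derivative - 1) (at t within S)"
    by (auto intro!: derivative_eq_intros)
  from vector_diff_chain_within[OF this assms] show ?thesis by (simp add: o_def)
qed

lemma solves_on_forward:
  assumes "\<And>t. (y has_vector_derivative - G (y t)) (at t)"
  shows "solves_on (\<lambda>x. - G x) y T"
  using assms by (auto simp: solves_on_def intro: has_vector_derivative_at_within)

lemma solves_on_backward:
  assumes "\<And>t. (y has_vector_derivative - G (y t)) (at t)"
  shows "solves_on G (\<lambda>t. y (- t)) T"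
  unfolding solves_on_def
proof
  fix t
  have "(y has_vector_derivative - G (y (- t))) (at (- t) within uminus ` {0..T})"
    using assms by (rule has_vector_derivative_at_within)
  from has_vector_derivative_reverse[OF this]
  show "((\<lambda>t. y (- t)) has_vector_derivative G (y (- t))) (at t within {0..T})" by simp
qed

lemma trajectory_unique:
  fixes G :: "'a::real_inner \<Rightarrow> 'a"
  assumes G: "locally_lipschitz G"
    and y: "\<And>t. (y has_vector_derivative - G (y t)) (at t)"
    and z: "\<And>t. (z has_vector_derivative - G (z t)) (at t)"
    and init: "y 0 = z 0"
  shows "y t = z t"
proof (cases "t \<ge> 0")
  case True
  then show ?thesis
    using solves_on_unique[OF locally_lipschitz_minus[OF G] solves_on_forward[OF z, of t]
        solves_on_forward[OF y, of t] init, of t] by simp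
next
  case False
  then show ?thesis
    using solves_on_unique[OF G solves_on_backward[OF z, of "- t"]
        solves_on_backward[OF y, of "- t"], of "- t"] init by simp
qed

theorem flow_exists_unique:
  fixes G :: "'a::{real_inner, complete_space} \<Rightarrow> 'a"
  assumes G: "locally_lipschitz G" and nonneg: "0 \<le> a" "0 \<le> b"
    and growth: "\<And>x. norm (G x) \<le> a * norm x + b"
  shows "\<exists>!\<phi>. generates_flow G \<phi>"
proof -
  have G': "locally_lipschitz (\<lambda>x. - G x)" by (rule locally_lipschitz_minus[OF G])
  have growth': "norm (- G x) \<le> a * norm x + b" for x using growth by simp
  have "\<exists>\<sigma>. \<sigma> 0 = x \<and> (\<forall>t. (\<sigma> has_vector_derivative - G (\<sigma> t)) (at t))" for x
  proof -
    obtain \<sigma> where \<sigma>: "\<sigma> 0 = x" "\<And>t. t \<ge> 0 \<Longrightarrow> (\<sigma> has_vector_derivative - G (\<sigma> t)) (at t within {0..})"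
      using forward_solution[OF G' nonneg growth', of x] by blast
    obtain \<sigma>' where \<sigma>': "\<sigma>' 0 = x" "\<And>t. t \<ge> 0 \<Longrightarrow> (\<sigma>' has_vector_derivative G (\<sigma>' t)) (at t within {0..})"
      using forward_solution[OF G nonneg growth, of x] by blast
    let ?\<eta> = "\<lambda>t. if t \<in> {0..} then \<sigma> t else \<sigma>' (- t)"
    have past: "((\<lambda>t. \<sigma>' (- t)) has_vector_derivative - G (\<sigma>' (- t))) (at t within {..0})"
      if "t \<le> 0" for t
    proof (rule has_vector_derivative_reverse)
      have "uminus ` {..0} = {0::real..}" by simp
      then show "(\<sigma>' has_vector_derivative G (\<sigma>' (- t))) (at (- t) within uminus ` {..0})"
        using \<sigma>'(2)[of "- t"] that by simp
    qed
    have "(?\<eta> has_vector_derivative (if t \<in> {0..} then - G (\<sigma> t) else - G (\<sigma>' (- t)))) (at t)" for t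
    proof (rule has_vector_derivative_If_within_closures[where T = "{..0}"])
      show "t \<in> {0..} \<union> {..0}" "UNIV = {0::real..} \<union> {..0}" by auto
      show "(\<sigma> has_vector_derivative - G (\<sigma> t)) (at t within {0..} \<union> closure {0..} \<inter> closure {..0})"
        if "t \<in> {0..} \<union> closure {0..} \<inter> closure {..0}"
      proof -
        have "{0..} \<union> closure {0..} \<inter> closure {..0} = {0::real..}" by auto
        then show ?thesis using that \<sigma>(2) by simp
      qed
      show "((\<lambda>t. \<sigma>' (- t)) has_vector_derivative - G (\<sigma>' (- t)))
          (at t within {..0} \<union> closure {0..} \<inter> closure {..0})"
        if "t \<in> {..0} \<union> closure {0..} \<inter> closure {..0}"
      proof -
        have "{..0} \<union> closure {0..} \<inter> closure {..0} = {..0::real}" by auto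
        then show ?thesis using that past by simp
      qed
      assume "t \<in> closure {0..}" "t \<in> closure {..0}"
      then have "t = 0" by simp
      then show "\<sigma> t = \<sigma>' (- t)" "- G (\<sigma> t) = - G (\<sigma>' (- t))" using \<sigma>(1) \<sigma>'(1) by simp_all
    qed
    then have "(?\<eta> has_vector_derivative - G (?\<eta> t)) (at t)" for t
      by (simp add: if_distrib[of "\<lambda>x. - G x"] cong: if_cong)
    moreover have "?\<eta> 0 = x" using \<sigma>(1) by simp
    ultimately show ?thesis by (intro exI[of _ ?\<eta>]) blast
  qed
  then obtain \<phi> where "\<And>x. \<phi> x 0 = x \<and> (\<forall>t. (\<phi> x has_vector_derivative - G (\<phi> x t)) (at t))"
    by metis
  then have "generates_flow G \<phi>" by (simp add: generates_flow_def)
  moreover have "\<psi> = \<phi>" if \<psi>: "generates_flow G \<psi>" and \<phi>: "generates_flow G \<phi>" for \<psi> \<phi>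
    using trajectory_unique[OF G, of "\<psi> _" "\<phi> _"] \<psi> \<phi>
    by (intro ext) (simp add: generates_flow_def)
  ultimately show ?thesis by blast
qed

lemma locally_lipschitz_add:
  assumes "locally_lipschitz f" "locally_lipschitz g"
  shows "locally_lipschitz (\<lambda>x. f x + g x)"
  unfolding locally_lipschitz_def
proof
  fix x
  obtain r K r' K' where f: "r > 0" "K-lipschitz_on (cball x r) f"
    and g: "r' > 0" "K'-lipschitz_on (cball x r') g"
    using assms unfolding locally_lipschitz_def by meson
  have "(K + K')-lipschitz_on (cball x (min r r')) (\<lambda>x. f x + g x)"
    by (intro lipschitz_on_add lipschitz_on_subset[OF f(2)] lipschitz_on_subset[OF g(2)] subset_cball) auto
  then show "\<exists>r>0. \<exists>K. K-lipschitz_on (cball x r) (\<lambda>x. f x + g x)"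
    using f(1) g(1) by (intro exI[of _ "min r r'"]) auto
qed

lemma local_lipschitz_imp_locally_lipschitz:
  assumes "local_lipschitz (UNIV :: real set) UNIV (\<lambda>_. Q)"
  shows "locally_lipschitz Q"
  unfolding locally_lipschitz_def
proof
  fix x
  obtain u K where "u > 0" "\<And>s. s \<in> cball 0 u \<inter> (UNIV :: real set) \<Longrightarrow> K-lipschitz_on (cball x u \<inter> UNIV) Q"
    using local_lipschitzE[OF assms, of 0 x] by auto
  from this(1) this(2)[of 0] show "\<exists>r>0. \<exists>K. K-lipschitz_on (cball x r) Q" by auto
qed

section \<open>The group generated by a bounded self-adjoint operator\<close>

lemma bounded_linear_locally_lipschitz:
  assumes "bounded_linear L"
  shows "locally_lipschitz L"
  unfolding locally_lipschitz_def
proof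
  fix x
  have "(onorm L)-lipschitz_on (cball x 1) L"
  proof (rule lipschitz_onI)
    fix u v
    show "dist (L u) (L v) \<le> onorm L * dist u v"
      using onorm[OF assms, of "u - v"] assms by (simp add: dist_norm linear_simps(2))
    show "0 \<le> onorm L" by (rule onorm_pos_le[OF assms])
  qed
  then show "\<exists>r>0. \<exists>K. K-lipschitz_on (cball x r) L" by (intro exI[of _ 1]) auto
qed

context
  fixes L :: "'a::{real_inner, complete_space} \<Rightarrow> 'a" and E :: "'a \<Rightarrow> real \<Rightarrow> 'a"
  assumes L: "bounded_linear L" and sa: "self_adjoint L" and E: "generates_flow (\<lambda>x. - L x) E"
begin

interpretation L: bounded_linear L by (rule L)

lemma group_zero: "E x 0 = x"
  using E by (simp add: generates_flow_def)

lemma group_derivative: "(E x has_vector_derivative L (E x t)) (at t)"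
  using E by (simp add: generates_flow_def)

lemma group_reverse_derivative:
  "((\<lambda>s. E x (t - s)) has_vector_derivative - L (E x (t - s))) (at s)"
proof -
  have "((\<lambda>s. t - s) has_vector_derivative - 1) (at s)"
    by (auto intro!: derivative_eq_intros)
  from vector_diff_chain_at[OF this group_derivative] show ?thesis by (simp add: o_def)
qed

lemma group_unique:
  assumes "\<And>t. (y has_vector_derivative L (y t)) (at t)"
  shows "y t = E (y 0) t"
proof (rule trajectory_unique[where G = "\<lambda>x. - L x"])
  show "locally_lipschitz (\<lambda>x. - L x)"
    by (intro locally_lipschitz_minus bounded_linear_locally_lipschitz L)
qed (use assms group_derivative group_zero in simp_all)

lemma group_add: "E (x + y) t = E x t + E y t"
proof -
  have "((\<lambda>t. E x t + E y t) has_vector_derivative L (E x t + E y t)) (at t)" for t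
    unfolding L.add by (intro has_vector_derivative_add group_derivative)
  from group_unique[OF this] show ?thesis by (simp add: group_zero)
qed

lemma group_diff: "E (x - y) t = E x t - E y t"
  using group_add[of "x - y" y t] by simp

lemma group_commutes: "E (L x) t = L (E x t)"
proof -
  have "((\<lambda>t. L (E x t)) has_vector_derivative L (L (E x t))) (at t)" for t
    by (rule L.has_vector_derivative[OF group_derivative])
  from group_unique[OF this] show ?thesis by (simp add: group_zero)
qed

text \<open>The derivative of the left-hand side in \<open>s\<close> vanishes because \<open>L\<close> is self-adjoint. The
  identity contains the self-adjointness of the group (\<open>s = t\<close>); together with the case
  \<open>t = 0\<close> it shows that \<open>E _ (- s)\<close> inverts \<open>E _ s\<close>.\<close>

lemma group_inner: "E x s \<bullet> E y (t - s) = x \<bullet> E y t"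
proof -
  have "((\<lambda>s. E x s \<bullet> E y (t - s)) has_real_derivative 0) (at s)" for s
  proof -
    have "((\<lambda>s. E x s \<bullet> E y (t - s)) has_vector_derivative
        E x s \<bullet> (- L (E y (t - s))) + L (E x s) \<bullet> E y (t - s)) (at s)"
      by (rule bounded_bilinear.has_vector_derivative[OF bounded_bilinear_inner
            group_derivative group_reverse_derivative])
    moreover have "E x s \<bullet> (- L (E y (t - s))) + L (E x s) \<bullet> E y (t - s) = 0"
      using sa by (simp add: self_adjoint_def)
    ultimately show ?thesis by (simp add: has_real_derivative_iff_has_vector_derivative)
  qed
  then have "\<forall>s. ((\<lambda>s. E x s \<bullet> E y (t - s)) has_real_derivative 0) (at s)" by blast
  from DERIV_isconst_all[OF this, of s 0] show ?thesis by (simp add: group_zero)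
qed

lemma group_self_adjoint: "E x t \<bullet> y = x \<bullet> E y t"
  using group_inner[of x t y t] by (simp add: group_zero)

lemma group_inverse: "E (E x t) (- t) = x"
proof -
  have "(E (E x t) (- t) - x) \<bullet> y = 0" for y
    using group_self_adjoint[of "E x t" "- t" y] group_inner[of x t y 0]
    by (simp add: inner_diff_left group_zero)
  from this[of "E (E x t) (- t) - x"] show ?thesis by simp
qed

lemma group_norm_bound: "norm (E x t) \<le> exp ((2 * onorm L + 1) * \<bar>t\<bar>) * norm x"
proof -
  let ?w = "\<lambda>s. E x (sgn t * s)" and ?c = "(2 * onorm L + 1) * \<bar>t\<bar>"
  have c: "0 \<le> ?c" using onorm_pos_le[OF L] by simp
  have "(?w has_vector_derivative (sgn t *\<^sub>R L (?w s))) (at s)" for s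
  proof -
    have "((\<lambda>s. sgn t * s) has_vector_derivative sgn t) (at s)"
      by (auto intro!: derivative_eq_intros)
    from vector_diff_chain_at[OF this group_derivative] show ?thesis by (simp add: o_def)
  qed
  note w' = this
  have "(norm (?w \<bar>t\<bar>))\<^sup>2 \<le> exp ?c * ((norm (?w 0))\<^sup>2 + 0\<^sup>2 * \<bar>t\<bar>)"
  proof (rule norm_growth_bound[where w' = "\<lambda>s. sgn t *\<^sub>R L (?w s)"])
    show "norm (sgn t *\<^sub>R L (?w s)) \<le> onorm L * norm (?w s) + 0" for s
    proof -
      have "norm (sgn t *\<^sub>R L (?w s)) \<le> 1 * norm (L (?w s))"
        unfolding norm_scaleR by (intro mult_right_mono) (auto simp: sgn_real_def)
      then show ?thesis using onorm[OF L, of "?w s"] by linarith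
    qed
    show "(?w has_vector_derivative (sgn t *\<^sub>R L (?w s))) (at s within {0..\<bar>t\<bar>})" for s
      using w' by (rule has_vector_derivative_at_within)
  qed (use onorm_pos_le[OF L] in auto)
  then have "(norm (E x t))\<^sup>2 \<le> exp ?c * (norm x)\<^sup>2"
    by (simp add: group_zero sgn_mult_abs)
  also have "\<dots> \<le> (exp ?c)\<^sup>2 * (norm x)\<^sup>2"
    using c by (intro mult_right_mono) (auto simp: power2_eq_square)
  finally have "(norm (E x t))\<^sup>2 \<le> (exp ?c * norm x)\<^sup>2" by (simp add: power_mult_distrib)
  then show ?thesis by (rule power2_le_imp_le) simp
qed

text \<open>In terms of the spectrum, this is \<open>2 cosh (2 t \<lambda>) \<ge> 4 t^2 \<lambda>^2\<close>. A
  vector that \<open>L\<close> does not annihilate becomes large in at least one direction of time. The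
  reason is convexity in \<open>t\<close>: the second derivative of the right-hand side
  is \<open>4 (norm (L (E z t)))^2 + 4 (norm (L (E z (- t))))^2\<close>, and this is at least
  \<open>8 (norm (L z))^2\<close> because the inner product of \<open>E (L z) t\<close> and
  \<open>E (L z) (- t)\<close> is \<open>(norm (L z))^2\<close> for all \<open>t\<close>.\<close>

lemma group_expansion:
  assumes t: "0 \<le> t"
  shows "4 * t\<^sup>2 * (norm (L z))\<^sup>2 \<le> (norm (E z t))\<^sup>2 + (norm (E z (- t)))\<^sup>2"
proof -
  define \<psi> where "\<psi> t = 2 * (E z t \<bullet> L (E z t)) - 2 * (E z (- t) \<bullet> L (E z (- t)))" for t
  define N where "N = (norm (L z))\<^sup>2"
  have rev: "((\<lambda>s. E z (- s)) has_vector_derivative - L (E z (- s))) (at s)" for s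
    using group_reverse_derivative[of z 0] by simp
  have LL: "w \<bullet> L (L w) = (norm (L w))\<^sup>2" for w
    using sa by (metis dot_square_norm self_adjoint_def)
  have \<psi>': "(\<psi> has_real_derivative 4 * (norm (L (E z s)))\<^sup>2 + 4 * (norm (L (E z (- s))))\<^sup>2) (at s)" for s
  proof -
    have "((\<lambda>s. E z s \<bullet> L (E z s)) has_real_derivative 2 * (norm (L (E z s)))\<^sup>2) (at s)"
      using bounded_bilinear.has_vector_derivative[OF bounded_bilinear_inner
          group_derivative[of z s] L.has_vector_derivative[OF group_derivative[of z s]]]
      by (simp add: has_real_derivative_iff_has_vector_derivative LL dot_square_norm)
    moreover have "((\<lambda>s. E z (- s) \<bullet> L (E z (- s))) has_real_derivative - 2 * (norm (L (E z (- s))))\<^sup>2) (at s)"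
      using bounded_bilinear.has_vector_derivative[OF bounded_bilinear_inner
          rev[of s] L.has_vector_derivative[OF rev[of s]]]
      by (simp add: has_real_derivative_iff_has_vector_derivative LL dot_square_norm L.neg)
    ultimately show ?thesis unfolding \<psi>_def by (auto intro!: derivative_eq_intros)
  qed
  have "8 * N \<le> 4 * (norm (L (E z s)))\<^sup>2 + 4 * (norm (L (E z (- s))))\<^sup>2" for s
  proof -
    have "N = E (L z) s \<bullet> E (L z) (- s)"
      using group_inner[of "L z" s "L z" 0] by (simp add: group_zero N_def dot_square_norm)
    also have "\<dots> = L (E z s) \<bullet> L (E z (- s))" by (simp add: group_commutes)
    also have "\<dots> \<le> norm (L (E z s)) * norm (L (E z (- s)))" by (rule norm_cauchy_schwarz)
    finally show ?thesis
      using sum_squares_bound[of "norm (L (E z s))" "norm (L (E z (- s)))"] by simp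
  qed
  note conv = this
  have "8 * N * s \<le> \<psi> s" if s: "0 \<le> s" for s
  proof -
    have "\<psi> 0 - 8 * N * 0 \<le> \<psi> s - 8 * N * s"
    proof (rule DERIV_nonneg_imp_nondecreasing[OF s])
      fix r
      have "((\<lambda>s. \<psi> s - 8 * N * s) has_real_derivative
          4 * (norm (L (E z r)))\<^sup>2 + 4 * (norm (L (E z (- r))))\<^sup>2 - 8 * N) (at r)"
        by (rule derivative_eq_intros \<psi>' refl | simp)+
      then show "\<exists>y. ((\<lambda>s. \<psi> s - 8 * N * s) has_real_derivative y) (at r) \<and> 0 \<le> y"
        using conv[of r] by (intro exI conjI) auto
    qed
    then show ?thesis by (simp add: \<psi>_def group_zero)
  qed
  note slope = this
  define f where "f s = (norm (E z s))\<^sup>2 + (norm (E z (- s)))\<^sup>2 - 4 * N * s\<^sup>2" for s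
  have "f 0 \<le> f t"
  proof (rule DERIV_nonneg_imp_nondecreasing[OF t])
    fix s :: real assume s: "0 \<le> s"
    have "(f has_real_derivative \<psi> s - 8 * N * s) (at s)" unfolding f_def \<psi>_def
      by (rule derivative_eq_intros norm_squared_has_derivative[OF group_derivative]
          norm_squared_has_derivative[OF rev] refl | simp)+
    then show "\<exists>y. (f has_real_derivative y) (at s) \<and> 0 \<le> y"
      using slope[OF s] by (intro exI conjI) auto
  qed
  moreover have "0 \<le> f 0" by (simp add: f_def)
  ultimately have "0 \<le> f t" by linarith
  then show ?thesis by (simp add: f_def N_def mult.commute mult.left_commute)
qed

lemma group_jointly_continuous: "continuous_on ({-T..T} \<times> UNIV) (\<lambda>(s, x). E x s)"
proof -
  let ?S = "{-T..T} \<times> (UNIV :: 'a set)" and ?A = "exp ((2 * onorm L + 1) * T)"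
  have "((\<lambda>(s, x). E x s) \<longlongrightarrow> E x0 s0) (at (s0, x0) within ?S)" for s0 x0
  proof -
    have "((\<lambda>z. E (snd z - x0) (fst z)) \<longlongrightarrow> 0) (at (s0, x0) within ?S)"
    proof (rule Lim_null_comparison)
      have "norm (E x s) \<le> ?A * norm x" if "s \<in> {-T..T}" for x s
      proof -
        have "exp ((2 * onorm L + 1) * \<bar>s\<bar>) \<le> ?A"
          using that onorm_pos_le[OF L] by (auto intro!: mult_left_mono)
        then show ?thesis using group_norm_bound[of x s] mult_right_mono[OF _ norm_ge_zero] order_trans by blast
      qed
      then show "\<forall>\<^sub>F z in at (s0, x0) within ?S. norm (E (snd z - x0) (fst z)) \<le> ?A * norm (snd z - x0)"
        unfolding eventually_at_filter by (intro always_eventually) auto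
      have "((\<lambda>z. ?A * norm (snd z - x0)) \<longlongrightarrow> ?A * norm (snd (s0, x0) - x0)) (at (s0, x0) within ?S)"
        by (intro tendsto_intros)
      then show "((\<lambda>z. ?A * norm (snd z - x0)) \<longlongrightarrow> 0) (at (s0, x0) within ?S)" by simp
    qed
    moreover have "((\<lambda>z. E x0 (fst z)) \<longlongrightarrow> E x0 s0) (at (s0, x0) within ?S)"
    proof (rule isCont_tendsto_compose[of s0 "E x0"])
      show "isCont (E x0) s0" using group_derivative has_vector_derivative_continuous by blast
      have "(fst \<longlongrightarrow> fst (s0, x0)) (at (s0, x0) within ?S)" by (intro tendsto_intros)
      then show "(fst \<longlongrightarrow> s0) (at (s0, x0) within ?S)" by simp
    qed
    ultimately have "((\<lambda>z. E (snd z - x0) (fst z) + E x0 (fst z)) \<longlongrightarrow> 0 + E x0 s0) (at (s0, x0) within ?S)"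
      by (rule tendsto_add)
    then show ?thesis by (simp add: group_diff case_prod_unfold)
  qed
  then show ?thesis unfolding continuous_on_def by auto
qed

text \<open>The variation of constants formula, tested against a vector \<open>v\<close>. Moving the group to
  \<open>v\<close> leaves a derivative of an inner product of two differentiable curves.\<close>

lemma variation_of_constants_weak:
  assumes \<gamma>: "\<And>t. (\<gamma> has_vector_derivative - L (\<gamma> t) - h t) (at t)"
  shows "((\<lambda>s. E (\<gamma> s) s \<bullet> v) has_real_derivative - (E (h s) s \<bullet> v)) (at s)"
proof -
  have "((\<lambda>s. \<gamma> s \<bullet> E v s) has_vector_derivative \<gamma> s \<bullet> L (E v s) + (- L (\<gamma> s) - h s) \<bullet> E v s) (at s)"
    by (rule bounded_bilinear.has_vector_derivative[OF bounded_bilinear_inner \<gamma> group_derivative])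
  moreover have "\<gamma> s \<bullet> L (E v s) + (- L (\<gamma> s) - h s) \<bullet> E v s = - (E (h s) s \<bullet> v)"
    using sa by (simp add: self_adjoint_def inner_diff_left group_self_adjoint)
  ultimately show ?thesis
    by (simp add: has_real_derivative_iff_has_vector_derivative group_self_adjoint)
qed

end

section \<open>Bounded solutions form a precompact set\<close>

lemma finite_net_through_map:
  fixes f :: "'b \<Rightarrow> 'c::metric_space"
  assumes "f ` A \<subseteq> C" "compact C" "d > 0"
  shows "\<exists>D\<subseteq>A. finite D \<and> (\<forall>a\<in>A. \<exists>b\<in>D. dist (f a) (f b) < d)"
proof -
  have "d / 2 > 0" using \<open>d > 0\<close> by simp
  then obtain k where k: "finite k" "C \<subseteq> (\<Union>x\<in>k. ball x (d / 2))"
    using assms(2) unfolding compact_eq_totally_bounded by meson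
  define g where "g x = (SOME a. a \<in> A \<and> f a \<in> ball x (d / 2))" for x
  define k' where "k' = {x \<in> k. \<exists>a. a \<in> A \<and> f a \<in> ball x (d / 2)}"
  have g: "g x \<in> A \<and> f (g x) \<in> ball x (d / 2)" if "x \<in> k'" for x
    using that someI_ex[of "\<lambda>a. a \<in> A \<and> f a \<in> ball x (d / 2)"] by (simp add: k'_def g_def)
  have "\<exists>b\<in>g ` k'. dist (f a) (f b) < d" if a: "a \<in> A" for a
  proof -
    obtain x where x: "x \<in> k" "f a \<in> ball x (d / 2)" using a assms(1) k(2) by fastforce
    then have "x \<in> k'" using a by (auto simp: k'_def)
    moreover have "dist (f a) (f (g x)) < d"
      using x(2) g[OF \<open>x \<in> k'\<close>] dist_triangle_half_r[of x "f a" d "f (g x)"] by auto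
    ultimately show ?thesis by blast
  qed
  moreover have "finite (g ` k')" "g ` k' \<subseteq> A" using k(1) g by (auto simp: k'_def)
  ultimately show ?thesis by blast
qed

text \<open>The span of a finite net.\<close>

lemma compact_near_finite_dim_subspace:
  fixes M :: "'a::real_inner set"
  assumes "compact M" "finite_dim_subspace N" "\<delta> > 0"
  obtains V where "finite_dim_subspace V" "N \<subseteq> V"
    "\<And>m. m \<in> M \<Longrightarrow> norm (m - orth_proj V m) < \<delta>"
proof -
  obtain B where B: "finite B" "N = span B" using assms(2) by (auto simp: finite_dim_subspace_def)
  obtain k where k: "finite k" "M \<subseteq> (\<Union>x\<in>k. ball x \<delta>)"
    using assms(1,3) unfolding compact_eq_totally_bounded by meson
  define V where "V = span (B \<union> k)"
  have V: "finite_dim_subspace V" unfolding V_def finite_dim_subspace_def using B(1) k(1) by blast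
  have "N \<subseteq> V" unfolding B(2) V_def by (intro span_mono) auto
  moreover have "norm (m - orth_proj V m) < \<delta>" if m: "m \<in> M" for m
  proof -
    obtain x where x: "x \<in> k" "m \<in> ball x \<delta>" using m k(2) by blast
    have "x \<in> V" unfolding V_def using x(1) by (intro span_base) simp
    then have "orth_proj V x = x" by (rule orth_proj_fixes[OF V])
    then have eq: "m - orth_proj V m = (m - x) - orth_proj V (m - x)"
      by (simp add: linear_diff[OF linear_orth_proj[OF V]])
    have "norm (m - orth_proj V m) \<le> norm (m - x)"
      unfolding eq by (rule norm_orth_proj_compl_le[OF V])
    then show ?thesis using x(2) by (simp add: dist_norm norm_minus_commute)
  qed
  ultimately show thesis using that V by blast
qed

text \<open>The heart of the proof. Consider solutions \<open>\<gamma>\<close> of \<open>\<gamma>' = - L \<gamma> - h\<close>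
  that stay in a bounded set for all times, while \<open>h\<close> takes values near a compact set. By
  variation of constants, \<open>\<gamma> 0 - E (\<gamma> T) T\<close> is the integral of \<open>E (h s) s\<close> from 0 to \<open>T\<close>, hence
  it is close to a finite-dimensional space \<open>V\<close>, and likewise for \<open>- T\<close>. So finitely many solutions suffice to approximate, for every solution, the three
  components in \<open>V\<close> that make up \<open>\<Phi> \<gamma>\<close>. If two solutions agree approximately in these
  components, then for the difference \<open>z\<close> of their initial points both \<open>E z T\<close> and
  \<open>E z (- T)\<close> are bounded by \<open>3 R\<close>. But the group expands \<open>z\<close>, so \<open>L z\<close> is at
  most of order \<open>R / T\<close>. The component of \<open>z\<close> in the kernel is controlled by the one in
  \<open>V\<close>, and the remaining one by \<open>L z\<close>.\<close>

proposition bounded_solutions_precompact: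
  fixes L :: "'a::{real_inner, complete_space} \<Rightarrow> 'a"
  assumes L: "bounded_linear L" "self_adjoint L" "fredholm L"
    and X: "bounded X" and K: "compact K" and e: "e > 0"
  shows "\<exists>\<epsilon>>0. \<exists>D. finite D \<and> (\<forall>\<gamma> h.
      (\<forall>t. (\<gamma> has_vector_derivative - L (\<gamma> t) - h t) (at t) \<and> \<gamma> t \<in> X \<and> (\<exists>k\<in>K. norm (h t - k) \<le> \<epsilon>))
      \<longrightarrow> (\<exists>x\<in>D. dist (\<gamma> 0) x < e))"
proof -
  interpret L: bounded_linear L by (rule L)
  define N where "N = {x. L x = 0}"
  have N: "finite_dim_subspace N" and "closed (range L)"
    using L(3) by (auto simp: fredholm_def N_def)
  obtain c where c: "c > 0" "\<And>u. (\<And>k. L k = 0 \<Longrightarrow> u \<bullet> k = 0) \<Longrightarrow> norm u \<le> c * norm (L u)"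
    using self_adjoint_closed_range_bounded_below[OF L(1,2) \<open>closed (range L)\<close>] by blast
  obtain E where E: "generates_flow (\<lambda>x. - L x) E"
    using flow_exists_unique[of "\<lambda>x. - L x" "onorm L" 0]
      locally_lipschitz_minus[OF bounded_linear_locally_lipschitz[OF L(1)]]
      onorm_pos_le[OF L(1)] onorm[OF L(1)] by auto
  note group = group_zero[OF L(1,2) E] group_diff[OF L(1,2) E] group_inverse[OF L(1,2) E]
  obtain R where R: "R > 0" "\<And>x. x \<in> X \<Longrightarrow> norm x \<le> R" using X by (auto simp: bounded_pos)

  \<comment> \<open>So long a time that \<open>c (3 R / T)\<close>, the final bound for the part of the difference
    orthogonal to the kernel, is \<open>e / 4\<close>.\<close>
  define T where "T = 12 * c * R / e"
  have T: "T > 0" using c R e by (simp add: T_def)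
  define A where "A = exp ((2 * onorm L + 1) * T)"
  have A1: "1 \<le> A" unfolding A_def using T onorm_pos_le[OF L(1)] by simp
  have A: "norm (E x s) \<le> A * norm x" if "\<bar>s\<bar> \<le> T" for x s
  proof -
    have "exp ((2 * onorm L + 1) * \<bar>s\<bar>) \<le> A"
      unfolding A_def using that onorm_pos_le[OF L(1)] by (auto intro!: mult_left_mono)
    then have "exp ((2 * onorm L + 1) * \<bar>s\<bar>) * norm x \<le> A * norm x" by (intro mult_right_mono) auto
    then show ?thesis using group_norm_bound[OF L(1,2) E, of x s] by linarith
  qed

  \<comment> \<open>The tolerances are divided by \<open>A\<close> because the error in \<open>E (\<gamma> T) T - \<gamma> 0\<close>
    is carried back by the group, and by \<open>T\<close> because it accumulates over that time. The
    factor 3 leaves room for one \<open>d\<close> and two \<open>err\<close> in the difference of two solutions.\<close>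
  define err where "err = R / (3 * A)"
  define d where "d = min (e / 4) (R / (3 * A))"
  define \<delta> where "\<delta> = err / (2 * T)"
  define \<epsilon> where "\<epsilon> = \<delta> / A"
  have pos: "err > 0" "d > 0" "\<delta> > 0" "\<epsilon> > 0"
    using R A1 T e by (auto simp: err_def d_def \<delta>_def \<epsilon>_def)
  have budget: "A * (d + 2 * err) \<le> R"
  proof -
    have "A * (d + 2 * err) \<le> A * (3 * (R / (3 * A)))"
      using A1 by (intro mult_left_mono) (auto simp: d_def err_def)
    then show ?thesis using A1 by simp
  qed

  \<comment> \<open>Up to \<open>\<delta>\<close>, the orbits of \<open>K\<close> during this time live in a finite-dimensional \<open>V\<close>.\<close>
  define M where "M = (\<lambda>(s, x). E x s) ` ({-T..T} \<times> K)"
  have "compact M" unfolding M_def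
    by (intro compact_continuous_image compact_Times K compact_Icc
        continuous_on_subset[OF group_jointly_continuous[OF L(1,2) E]]) auto
  then obtain V where V: "finite_dim_subspace V" "N \<subseteq> V"
    and MV: "\<And>m. m \<in> M \<Longrightarrow> norm (m - orth_proj V m) < \<delta>"
    using compact_near_finite_dim_subspace[OF _ N pos(3)] by blast
  define p where "p = orth_proj V"
  have p_diff: "p (x - y) = p x - p y" for x y
    unfolding p_def by (rule linear_diff[OF linear_orth_proj[OF V(1)]])
  note p_orth = orth_proj_orthogonal[OF V(1), folded p_def]
  have p_compl: "norm (x - p x) \<le> norm x" for x
    unfolding p_def by (rule norm_orth_proj_compl_le[OF V(1)])

  define Sol where "Sol = {\<gamma>. \<exists>h. \<forall>t. (\<gamma> has_vector_derivative - L (\<gamma> t) - h t) (at t)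
      \<and> \<gamma> t \<in> X \<and> (\<exists>k\<in>K. norm (h t - k) \<le> \<epsilon>)}"
  define w where "w \<gamma> \<tau> = E (\<gamma> \<tau>) \<tau> - \<gamma> 0" for \<gamma> and \<tau> :: real
  have w_near_V: "norm (w \<gamma> \<tau> - p (w \<gamma> \<tau>)) \<le> err" if \<gamma>: "\<gamma> \<in> Sol" and \<tau>: "\<bar>\<tau>\<bar> \<le> T" for \<gamma> \<tau>
  proof -
    obtain h where h: "\<And>t. (\<gamma> has_vector_derivative - L (\<gamma> t) - h t) (at t)"
      "\<And>t. \<exists>k\<in>K. norm (h t - k) \<le> \<epsilon>" using \<gamma> by (auto simp: Sol_def)
    \<comment> \<open>Testing against the part of \<open>w\<close> orthogonal to \<open>V\<close> recovers the norm of that part.\<close>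
    define v where "v = w \<gamma> \<tau> - p (w \<gamma> \<tau>)"
    have v: "u \<bullet> v = 0" if "u \<in> V" for u using p_orth[OF that] by (simp add: v_def inner_commute)
    have small: "\<bar>E (h s) s \<bullet> v\<bar> \<le> (2 * \<delta>) * norm v" if s: "s \<in> {-T..T}" for s
    proof -
      obtain k where k: "k \<in> K" "norm (h s - k) \<le> \<epsilon>" using h(2) by blast
      have "E k s \<in> M" unfolding M_def using s k(1) by force
      then have "norm (E k s - p (E k s)) \<le> \<delta>" using MV by (simp add: p_def less_imp_le)
      moreover have "norm (E (h s - k) s) \<le> \<delta>"
      proof -
        have "norm (E (h s - k) s) \<le> A * norm (h s - k)" using s by (intro A) auto
        also have "\<dots> \<le> A * \<epsilon>" using A1 k(2) by (intro mult_left_mono) auto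
        finally show ?thesis using A1 by (simp add: \<epsilon>_def)
      qed
      ultimately have bd: "norm ((E k s - p (E k s)) + E (h s - k) s) \<le> 2 * \<delta>"
        using norm_triangle_ineq[of "E k s - p (E k s)" "E (h s - k) s"] by simp
      have "p (E k s) \<bullet> v = 0" by (rule v) (simp add: p_def orth_proj_in[OF V(1)])
      then have "E (h s) s \<bullet> v = ((E k s - p (E k s)) + E (h s - k) s) \<bullet> v"
        by (simp add: group inner_add_left inner_diff_left)
      also have "\<bar>\<dots>\<bar> \<le> norm ((E k s - p (E k s)) + E (h s - k) s) * norm v"
        by (rule Cauchy_Schwarz_ineq2)
      also have "\<dots> \<le> (2 * \<delta>) * norm v" using bd by (intro mult_right_mono) auto
      finally show ?thesis .
    qed
    have "norm (E (\<gamma> \<tau>) \<tau> \<bullet> v - E (\<gamma> 0) 0 \<bullet> v) \<le> ((2 * \<delta>) * norm v) * norm (\<tau> - 0)"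
    proof (rule field_differentiable_bound)
      show "((\<lambda>s. E (\<gamma> s) s \<bullet> v) has_real_derivative - (E (h s) s \<bullet> v)) (at s within {-T..T})" for s
        by (rule has_field_derivative_at_within[OF variation_of_constants_weak[OF L(1,2) E h(1)]])
      show "norm (- (E (h s) s \<bullet> v)) \<le> 2 * \<delta> * norm v" if "s \<in> {-T..T}" for s
        using small[OF that] by simp
    qed (use T \<tau> in auto)
    also have "\<dots> \<le> ((2 * \<delta>) * norm v) * T" using \<tau> pos by (intro mult_left_mono) auto
    also have "\<dots> = err * norm v" using T by (simp add: \<delta>_def)
    also have "E (\<gamma> \<tau>) \<tau> \<bullet> v - E (\<gamma> 0) 0 \<bullet> v = w \<gamma> \<tau> \<bullet> v" by (simp add: w_def group inner_diff_left)
    also have "w \<gamma> \<tau> \<bullet> v = v \<bullet> v + p (w \<gamma> \<tau>) \<bullet> v" by (simp add: v_def inner_diff_left)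
    also have "p (w \<gamma> \<tau>) \<bullet> v = 0" by (rule v) (simp add: p_def orth_proj_in[OF V(1)])
    finally have "norm v * norm v \<le> err * norm v" by (simp add: dot_square_norm power2_eq_square)
    then have "norm v \<le> err" using pos(1) by (cases "v = 0") auto
    then show ?thesis by (simp add: v_def)
  qed

  define \<Phi> where "\<Phi> \<gamma> = (p (\<gamma> 0), p (w \<gamma> T), p (w \<gamma> (- T)))" for \<gamma>
  define C where "C = V \<inter> cball 0 (A * R + R)"
  have "compact C" unfolding C_def
    by (rule finite_dim_compact[OF V(1)])
       (auto intro!: closed_Int closed_finite_dim_subspace[OF V(1)] bounded_subset[OF bounded_cball])
  have pC: "p u \<in> C" if "norm u \<le> A * R + R" for u
    using that norm_orth_proj_le[OF V(1), of u] orth_proj_in[OF V(1)] by (auto simp: C_def p_def)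
  have \<gamma>R: "norm (\<gamma> t) \<le> R" if "\<gamma> \<in> Sol" for \<gamma> t using that R(2) by (auto simp: Sol_def)
  have "\<Phi> ` Sol \<subseteq> C \<times> C \<times> C"
  proof
    fix u assume "u \<in> \<Phi> ` Sol"
    then obtain \<gamma> where \<gamma>: "\<gamma> \<in> Sol" "u = \<Phi> \<gamma>" by blast
    have w: "norm (w \<gamma> \<tau>) \<le> A * R + R" if "\<bar>\<tau>\<bar> \<le> T" for \<tau>
    proof -
      have "norm (w \<gamma> \<tau>) \<le> norm (E (\<gamma> \<tau>) \<tau>) + norm (\<gamma> 0)" unfolding w_def by (rule norm_triangle_ineq4)
      moreover have "A * norm (\<gamma> \<tau>) \<le> A * R" using A1 \<gamma>R[OF \<gamma>(1)] by (intro mult_left_mono) auto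
      ultimately show ?thesis using A[OF that, of "\<gamma> \<tau>"] \<gamma>R[OF \<gamma>(1), of 0] by linarith
    qed
    have "norm (\<gamma> 0) \<le> A * R + R" using \<gamma>R[OF \<gamma>(1), of 0] A1 R(1)
      by (intro order_trans[OF _ le_add_same_cancel2[THEN iffD2]]) auto
    then show "u \<in> C \<times> C \<times> C" unfolding \<gamma>(2) \<Phi>_def using w T by (auto intro!: pC)
  qed
  moreover have "compact (C \<times> C \<times> C)" using \<open>compact C\<close> by (intro compact_Times)
  ultimately have "\<exists>D\<subseteq>Sol. finite D \<and> (\<forall>\<gamma>\<in>Sol. \<exists>\<gamma>'\<in>D. dist (\<Phi> \<gamma>) (\<Phi> \<gamma>') < d)"
    using pos(2) by (rule finite_net_through_map)
  then obtain D where D: "D \<subseteq> Sol" "finite D" "\<forall>\<gamma>\<in>Sol. \<exists>\<gamma>'\<in>D. dist (\<Phi> \<gamma>) (\<Phi> \<gamma>') < d"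
    by blast

  have close: "dist (\<gamma> 0) (\<gamma>' 0) < e"
    if \<gamma>: "\<gamma> \<in> Sol" "\<gamma>' \<in> Sol" and \<Phi>: "dist (\<Phi> \<gamma>) (\<Phi> \<gamma>') < d" for \<gamma> \<gamma>'
  proof -
    define z where "z = \<gamma> 0 - \<gamma>' 0"
    have "dist (p (\<gamma> 0)) (p (\<gamma>' 0)) < d"
      using dist_fst_le[of "\<Phi> \<gamma>" "\<Phi> \<gamma>'"] \<Phi> by (simp add: \<Phi>_def)
    then have pz: "norm (p z) < d" by (simp add: z_def p_diff dist_norm)
    have snd: "dist (snd (\<Phi> \<gamma>)) (snd (\<Phi> \<gamma>')) < d"
      using dist_snd_le[of "\<Phi> \<gamma>" "\<Phi> \<gamma>'"] \<Phi> by simp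
    have pw: "dist (p (w \<gamma> \<tau>)) (p (w \<gamma>' \<tau>)) < d" if "\<tau> \<in> {T, - T}" for \<tau>
      using dist_fst_le[of "snd (\<Phi> \<gamma>)" "snd (\<Phi> \<gamma>')"] dist_snd_le[of "snd (\<Phi> \<gamma>)" "snd (\<Phi> \<gamma>')"] snd that
      by (auto simp: \<Phi>_def)
    have Ez: "norm (E z (- \<tau>)) \<le> 3 * R" if \<tau>: "\<tau> \<in> {T, - T}" for \<tau>
    proof -
      define W where "W = w \<gamma> \<tau> - w \<gamma>' \<tau>"
      have \<tau>T: "\<bar>\<tau>\<bar> \<le> T" using \<tau> T by auto
      have "W = (p (w \<gamma> \<tau>) - p (w \<gamma>' \<tau>)) + ((w \<gamma> \<tau> - p (w \<gamma> \<tau>)) - (w \<gamma>' \<tau> - p (w \<gamma>' \<tau>)))"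
        by (simp add: W_def)
      then have "norm W \<le> norm (p (w \<gamma> \<tau>) - p (w \<gamma>' \<tau>))
          + norm ((w \<gamma> \<tau> - p (w \<gamma> \<tau>)) - (w \<gamma>' \<tau> - p (w \<gamma>' \<tau>)))"
        by (metis norm_triangle_ineq)
      then have "norm W \<le> d + 2 * err"
        using pw[OF \<tau>] w_near_V[OF \<gamma>(1) \<tau>T] w_near_V[OF \<gamma>(2) \<tau>T]
          norm_triangle_ineq4[of "w \<gamma> \<tau> - p (w \<gamma> \<tau>)" "w \<gamma>' \<tau> - p (w \<gamma>' \<tau>)"]
        by (simp add: dist_norm)
      then have "A * norm W \<le> A * (d + 2 * err)" using A1 by (intro mult_left_mono) auto
      then have "norm (E W (- \<tau>)) \<le> R" using A[of "- \<tau>" W] \<tau>T budget by simp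
      moreover have "E z (- \<tau>) = (\<gamma> \<tau> - \<gamma>' \<tau>) - E W (- \<tau>)"
        by (simp add: z_def W_def w_def group)
      moreover have "norm ((\<gamma> \<tau> - \<gamma>' \<tau>) - E W (- \<tau>)) \<le> norm (\<gamma> \<tau>) + norm (\<gamma>' \<tau>) + norm (E W (- \<tau>))"
        using norm_triangle_ineq4[of "\<gamma> \<tau> - \<gamma>' \<tau>" "E W (- \<tau>)"] norm_triangle_ineq4[of "\<gamma> \<tau>" "\<gamma>' \<tau>"]
        by simp
      ultimately show ?thesis using \<gamma>R[OF \<gamma>(1), of \<tau>] \<gamma>R[OF \<gamma>(2), of \<tau>] by simp
    qed
    have "(2 * T * norm (L z))\<^sup>2 \<le> (norm (E z T))\<^sup>2 + (norm (E z (- T)))\<^sup>2"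
      using group_expansion[OF L(1,2) E, of T z] T by (simp add: power_mult_distrib)
    also have "\<dots> \<le> (3 * R)\<^sup>2 + (3 * R)\<^sup>2"
      using Ez[of T] Ez[of "- T"] by (intro add_mono power_mono) auto
    also have "\<dots> \<le> (6 * R)\<^sup>2" by (simp add: power_mult_distrib)
    finally have "2 * T * norm (L z) \<le> 6 * R" by (rule power2_le_imp_le) (use R(1) in simp)
    then have "norm (L z) \<le> 3 * R / T" using T by (simp add: pos_le_divide_eq mult.commute)
    then have "c * norm (L z) \<le> c * (3 * R / T)" using c(1) by (intro mult_left_mono) auto
    also have "\<dots> = e / 4" using c(1) R(1) e by (simp add: T_def)
    finally have cLz: "c * norm (L z) \<le> e / 4" .
    define n where "n = orth_proj N z"
    have "n \<in> N" unfolding n_def by (rule orth_proj_in[OF N])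
    have "norm (z - n) \<le> c * norm (L (z - n))"
    proof (rule c(2))
      show "(z - n) \<bullet> k = 0" if "L k = 0" for k
        unfolding n_def using that by (intro orth_proj_orthogonal[OF N]) (simp add: N_def)
    qed
    moreover have "L (z - n) = L z" using \<open>n \<in> N\<close> by (simp add: L.diff N_def)
    moreover have "norm n \<le> norm (p z)"
    proof -
      have "orth_proj N (z - p z) = 0"
        using V(2) p_orth by (intro orth_proj_eq_0[OF N]) auto
      then have "n = orth_proj N (p z)"
        unfolding n_def by (simp add: linear_diff[OF linear_orth_proj[OF N]])
      then show ?thesis using norm_orth_proj_le[OF N] by simp
    qed
    ultimately have "norm z \<le> norm (p z) + c * norm (L z)"
      using norm_triangle_ineq[of n "z - n"] by simp
    also have "\<dots> < e" using pz cLz e by (simp add: d_def)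
    finally show ?thesis by (simp add: z_def dist_norm)
  qed

  have "\<forall>\<gamma> h. (\<forall>t. (\<gamma> has_vector_derivative - L (\<gamma> t) - h t) (at t) \<and> \<gamma> t \<in> X
      \<and> (\<exists>k\<in>K. norm (h t - k) \<le> \<epsilon>)) \<longrightarrow> (\<exists>x\<in>(\<lambda>\<gamma>. \<gamma> 0) ` D. dist (\<gamma> 0) x < e)"
  proof (intro allI impI)
    fix \<gamma> h
    assume "\<forall>t. (\<gamma> has_vector_derivative - L (\<gamma> t) - h t) (at t) \<and> \<gamma> t \<in> X
        \<and> (\<exists>k\<in>K. norm (h t - k) \<le> \<epsilon>)"
    then have "\<gamma> \<in> Sol" unfolding Sol_def by blast
    then obtain \<gamma>' where \<gamma>': "\<gamma>' \<in> D" "dist (\<Phi> \<gamma>) (\<Phi> \<gamma>') < d" using D(3) by blast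
    then have "dist (\<gamma> 0) (\<gamma>' 0) < e" using close[OF \<open>\<gamma> \<in> Sol\<close>] D(1) by blast
    then show "\<exists>x\<in>(\<lambda>\<gamma>. \<gamma> 0) ` D. dist (\<gamma> 0) x < e" using \<gamma>'(1) by blast
  qed
  moreover have "finite ((\<lambda>\<gamma>. \<gamma> 0) ` D)" using D(2) by simp
  ultimately show ?thesis using pos(4) by blast
qed

section \<open>Isolation survives small perturbations\<close>

lemma totally_bounded_sequence_has_limit_point:
  fixes y :: "nat \<Rightarrow> 'a::complete_space"
  assumes "\<And>e. e > 0 \<Longrightarrow> \<exists>D N. finite D \<and> (\<forall>n\<ge>N. \<exists>x\<in>D. dist (y n) x < e)"
  obtains l r where "strict_mono (r :: nat \<Rightarrow> nat)" "(y \<circ> r) \<longlonglongrightarrow> l"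
proof -
  have "\<exists>k. finite k \<and> closure (range y) \<subseteq> (\<Union>x\<in>k. ball x e)" if e: "e > 0" for e
  proof -
    have "e / 2 > 0" using e by simp
    from assms[OF this] obtain D N where D: "finite D" "\<And>n. n \<ge> N \<Longrightarrow> \<exists>x\<in>D. dist (y n) x < e / 2" by blast
    define k where "k = D \<union> y ` {..<N}"
    have "range y \<subseteq> (\<Union>x\<in>k. cball x (e / 2))"
    proof
      fix u assume "u \<in> range y"
      then obtain n where n: "u = y n" by blast
      show "u \<in> (\<Union>x\<in>k. cball x (e / 2))"
      proof (cases "n < N")
        case True
        then show ?thesis using n e by (intro UN_I[of "y n"]) (auto simp: k_def)
      next
        case False
        then obtain x where "x \<in> D" "dist (y n) x < e / 2" using D(2)[of n] by auto
        then show ?thesis using n by (intro UN_I[of x]) (auto simp: k_def dist_commute)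
      qed
    qed
    moreover have "finite k" using D(1) by (simp add: k_def)
    ultimately have "closure (range y) \<subseteq> (\<Union>x\<in>k. cball x (e / 2))"
      by (intro closure_minimal closed_UN) auto
    also have "\<dots> \<subseteq> (\<Union>x\<in>k. ball x e)" using e by (intro UN_mono) auto
    finally show ?thesis using \<open>finite k\<close> by blast
  qed
  then have "compact (closure (range y))"
    unfolding compact_eq_totally_bounded by (simp add: complete_eq_closed)
  then have sc: "seq_compact (closure (range y))" by (rule compact_imp_seq_compact)
  have "\<forall>n. y n \<in> closure (range y)" by (intro allI subsetD[OF closure_subset] rangeI)
  then show thesis by (rule seq_compactE[OF sc]) (rule that)
qed

text \<open>If fields \<open>G n\<close> converge to \<open>F\<close> uniformly on \<open>X\<close> and each has a full
  trajectory in \<open>X\<close> through a point \<open>y n\<close> outside the interior of \<open>X\<close>, then the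
  precompactness of bounded solutions makes a subsequence of \<open>y n\<close> converge. The trajectory of
  \<open>F\<close> through the limit is a pointwise limit of trajectories in \<open>X\<close>, so the limit is an
  interior point of \<open>X\<close>, and so are almost all points of the subsequence.\<close>

theorem isolation_stable:
  fixes F L Q :: "'a::{real_inner, complete_space} \<Rightarrow> 'a"
  assumes F: "permissible_decomposition F L Q" and \<eta>: "generates_flow F \<eta>"
    and X: "isolating_nbhd_in UNIV X \<eta>"
  shows "\<exists>\<epsilon>>0. \<forall>G \<phi>. generates_flow G \<phi> \<and> (\<forall>x\<in>X. norm (G x - F x) \<le> \<epsilon>)
    \<longrightarrow> isolating_nbhd_in UNIV X \<phi>"
proof (rule ccontr)
  assume contra: "\<not> ?thesis"
  have L: "bounded_linear L" "self_adjoint L" "fredholm L" and FLQ: "\<And>x. F x = L x + Q x"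
    and Q: "local_lipschitz (UNIV :: real set) UNIV (\<lambda>_. Q)" "compact_operator Q"
    using F unfolding permissible_decomposition_def by blast+
  have clX: "closed X" and bdX: "bounded X" and invX: "inv_set X \<eta> \<subseteq> interior X"
    using X by (simp_all add: isolating_nbhd_in_def flip: closed_closedin)
  define K where "K = closure (Q ` X)"
  have K: "compact K" using Q(2) bdX by (simp add: compact_operator_def K_def)
  have "\<forall>n. \<exists>G \<phi> y. generates_flow G \<phi> \<and> (\<forall>x\<in>X. norm (G x - F x) \<le> inverse (real (Suc n)))
      \<and> y \<in> inv_set X \<phi> \<and> y \<notin> interior X"
  proof
    fix n
    have "inverse (real (Suc n)) > 0" by simp
    with contra obtain G \<phi> where G: "generates_flow G \<phi>" "\<forall>x\<in>X. norm (G x - F x) \<le> inverse (real (Suc n))"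
      and "\<not> isolating_nbhd_in UNIV X \<phi>" by blast
    then have "\<not> inv_set X \<phi> \<subseteq> interior X"
      using clX bdX by (simp add: isolating_nbhd_in_def flip: closed_closedin)
    with G show "\<exists>G \<phi> y. generates_flow G \<phi> \<and> (\<forall>x\<in>X. norm (G x - F x) \<le> inverse (real (Suc n)))
      \<and> y \<in> inv_set X \<phi> \<and> y \<notin> interior X" by blast
  qed
  then obtain G \<phi> y where flow: "\<And>n. generates_flow (G n) (\<phi> n)"
    and near: "\<And>n x. x \<in> X \<Longrightarrow> norm (G n x - F x) \<le> inverse (real (Suc n))"
    and inv: "\<And>n. y n \<in> inv_set X (\<phi> n)" and out: "\<And>n. y n \<notin> interior X"
    by metis
  define \<gamma> where "\<gamma> n = \<phi> n (y n)" for n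
  have \<gamma>X: "\<gamma> n t \<in> X" for n t using inv by (auto simp: inv_set_def \<gamma>_def)
  have \<gamma>0: "\<gamma> n 0 = y n" for n using flow by (simp add: generates_flow_def \<gamma>_def)
  have \<gamma>': "(\<gamma> n has_vector_derivative - G n (\<gamma> n t)) (at t)" for n t
    using flow by (simp add: generates_flow_def \<gamma>_def)

  have "\<exists>D N. finite D \<and> (\<forall>n\<ge>N. \<exists>x\<in>D. dist (y n) x < e)" if e: "e > 0" for e
  proof -
    obtain \<epsilon> D where \<epsilon>: "\<epsilon> > 0" "finite D" and cover: "\<And>\<gamma> h.
      \<forall>t. (\<gamma> has_vector_derivative - L (\<gamma> t) - h t) (at t) \<and> \<gamma> t \<in> X \<and> (\<exists>k\<in>K. norm (h t - k) \<le> \<epsilon>)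
      \<Longrightarrow> \<exists>x\<in>D. dist (\<gamma> 0) x < e"
      using bounded_solutions_precompact[OF L bdX K e] by blast
    obtain N where N: "inverse (real (Suc N)) < \<epsilon>" using reals_Archimedean[OF \<epsilon>(1)] by blast
    have "\<exists>x\<in>D. dist (y n) x < e" if n: "n \<ge> N" for n
    proof -
      have "inverse (real (Suc n)) \<le> inverse (real (Suc N))" using n by (intro le_imp_inverse_le) auto
      then have nearN: "norm (G n x - F x) \<le> \<epsilon>" if "x \<in> X" for x using near[OF that, of n] N by linarith
      have "\<exists>x\<in>D. dist (\<gamma> n 0) x < e"
      proof (rule cover[of _ "\<lambda>t. G n (\<gamma> n t) - L (\<gamma> n t)"], intro allI conjI)
        fix t
        show "(\<gamma> n has_vector_derivative - L (\<gamma> n t) - (G n (\<gamma> n t) - L (\<gamma> n t))) (at t)"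
          using \<gamma>' by simp
        show "\<gamma> n t \<in> X" by (rule \<gamma>X)
        show "\<exists>k\<in>K. norm (G n (\<gamma> n t) - L (\<gamma> n t) - k) \<le> \<epsilon>"
        proof
          show "Q (\<gamma> n t) \<in> K" unfolding K_def by (intro subsetD[OF closure_subset] imageI \<gamma>X)
          show "norm (G n (\<gamma> n t) - L (\<gamma> n t) - Q (\<gamma> n t)) \<le> \<epsilon>"
            using nearN[OF \<gamma>X, of n t] by (simp add: FLQ algebra_simps)
        qed
      qed
      then show ?thesis by (simp add: \<gamma>0)
    qed
    with \<epsilon>(2) show ?thesis by blast
  qed
  then obtain r x where r: "strict_mono (r :: nat \<Rightarrow> nat)" "(y \<circ> r) \<longlonglongrightarrow> x"
    by (rule totally_bounded_sequence_has_limit_point)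

  have F_lip: "locally_lipschitz F"
    using locally_lipschitz_add[OF bounded_linear_locally_lipschitz[OF L(1)] local_lipschitz_imp_locally_lipschitz[OF Q(1)]]
    by (subst ext[OF FLQ])
  have lim: "(\<lambda>n. \<gamma> (r n) t) \<longlonglongrightarrow> \<eta> x t" for t
  proof -
    have \<eta>': "(\<eta> x has_vector_derivative - F (\<eta> x t)) (at t)" for t
      using \<eta> by (simp add: generates_flow_def)
    have \<eta>0: "\<eta> x 0 = x" using \<eta> by (simp add: generates_flow_def)
    have ev: "\<forall>\<^sub>F n in sequentially. inverse (real (Suc (r n))) \<le> d \<and> norm (y (r n) - x) \<le> d" if "d > 0" for d
    proof (rule eventually_conj)
      have "filterlim r at_top sequentially" by (rule filterlim_subseq[OF r(1)])
      from filterlim_compose[OF LIMSEQ_inverse_real_of_nat this]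
      have "(\<lambda>n. inverse (real (Suc (r n)))) \<longlonglongrightarrow> 0" .
      from order_tendstoD(2)[OF this that]
      show "\<forall>\<^sub>F n in sequentially. inverse (real (Suc (r n))) \<le> d" by (rule eventually_mono) (rule less_imp_le)
      from tendstoD[OF r(2) that]
      show "\<forall>\<^sub>F n in sequentially. norm (y (r n) - x) \<le> d"
        by (rule eventually_mono) (simp add: dist_norm)
    qed
    show ?thesis
    proof (rule tendstoI)
      fix e :: real assume e: "e > 0"
      show "\<forall>\<^sub>F n in sequentially. dist (\<gamma> (r n) t) (\<eta> x t) < e"
      proof (cases "t \<ge> 0")
        case True
        obtain d where d: "d > 0" "\<forall>\<gamma> g. (\<forall>s\<in>{0..t}. (\<gamma> has_vector_derivative g s) (at s within {0..t})
            \<and> norm (g s - - F (\<gamma> s)) \<le> d) \<and> norm (\<gamma> 0 - \<eta> x 0) \<le> d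
          \<longrightarrow> (\<forall>s\<in>{0..t}. norm (\<gamma> s - \<eta> x s) < e)"
          using trajectory_perturbation[OF locally_lipschitz_minus[OF F_lip] solves_on_forward[OF \<eta>', of t] e] by blast
        from ev[OF d(1)] show ?thesis
        proof (rule eventually_mono)
          fix n assume n: "inverse (real (Suc (r n))) \<le> d \<and> norm (y (r n) - x) \<le> d"
          have "norm (- G (r n) (\<gamma> (r n) s) - - F (\<gamma> (r n) s)) \<le> d" for s
            using near[OF \<gamma>X[of "r n" s], of "r n"] n by (simp add: norm_minus_commute)
          then have "\<forall>s\<in>{0..t}. norm (\<gamma> (r n) s - \<eta> x s) < e"
            by (intro mp[OF spec[OF spec[OF d(2), of "\<gamma> (r n)"], of "\<lambda>s. - G (r n) (\<gamma> (r n) s)"]])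
               (use n in \<open>simp add: \<gamma>0 \<eta>0 has_vector_derivative_at_within[OF \<gamma>']\<close>)
          then show "dist (\<gamma> (r n) t) (\<eta> x t) < e" using True by (simp add: dist_norm)
        qed
      next
        case False
        obtain d where d: "d > 0" "\<forall>\<gamma> g. (\<forall>s\<in>{0..- t}. (\<gamma> has_vector_derivative g s) (at s within {0..- t})
            \<and> norm (g s - F (\<gamma> s)) \<le> d) \<and> norm (\<gamma> 0 - \<eta> x (- 0)) \<le> d
          \<longrightarrow> (\<forall>s\<in>{0..- t}. norm (\<gamma> s - \<eta> x (- s)) < e)"
          using trajectory_perturbation[OF F_lip solves_on_backward[OF \<eta>', of "- t"] e] by blast
        from ev[OF d(1)] show ?thesis
        proof (rule eventually_mono)
          fix n assume n: "inverse (real (Suc (r n))) \<le> d \<and> norm (y (r n) - x) \<le> d"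
          have "norm (G (r n) (\<gamma> (r n) (- s)) - F (\<gamma> (r n) (- s))) \<le> d" for s
            using near[OF \<gamma>X[of "r n" "- s"], of "r n"] n by simp
          moreover have "\<forall>s\<in>{0..- t}. ((\<lambda>s. \<gamma> (r n) (- s)) has_vector_derivative
              G (r n) (\<gamma> (r n) (- s))) (at s within {0..- t})"
            using solves_on_backward[where y = "\<gamma> (r n)" and G = "G (r n)" and T = "- t", OF \<gamma>'] by (simp add: solves_on_def)
          ultimately have "\<forall>s\<in>{0..- t}. norm (\<gamma> (r n) (- s) - \<eta> x (- s)) < e"
            by (intro mp[OF spec[OF spec[OF d(2), of "\<lambda>s. \<gamma> (r n) (- s)"],
                of "\<lambda>s. G (r n) (\<gamma> (r n) (- s))"]])
               (use n in \<open>simp add: \<gamma>0 \<eta>0\<close>)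
          from bspec[OF this, of "- t"] show "dist (\<gamma> (r n) t) (\<eta> x t) < e"
            using False by (simp add: dist_norm)
        qed
      qed
    qed
  qed
  have \<eta>X: "\<eta> x t \<in> X" for t
    by (rule closed_sequentially[OF clX _ lim]) (simp add: \<gamma>X)
  moreover have "x \<in> X" using \<eta>X[of 0] \<eta> by (simp add: generates_flow_def)
  ultimately have "x \<in> inv_set X \<eta>" by (simp add: inv_set_def)
  then have "x \<in> interior X" using invX by blast
  from topological_tendstoD[OF r(2) open_interior this]
  obtain n where "(y \<circ> r) n \<in> interior X" unfolding eventually_sequentially by blast
  then show False using out by simp
qed

section \<open>Finite-dimensional approximations\<close>

lemma locally_lipschitz_compose:
  assumes P: "bounded_linear P" and Q: "locally_lipschitz Q"
  shows "locally_lipschitz (\<lambda>x. P (Q x))"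
  unfolding locally_lipschitz_def
proof
  fix x
  obtain r K where r: "r > 0" "K-lipschitz_on (cball x r) Q"
    using Q unfolding locally_lipschitz_def by meson
  have "(onorm P * K)-lipschitz_on (cball x r) (\<lambda>x. P (Q x))"
  proof (rule lipschitz_onI)
    fix u v assume uv: "u \<in> cball x r" "v \<in> cball x r"
    have "dist (P (Q u)) (P (Q v)) \<le> onorm P * dist (Q u) (Q v)"
      using onorm[OF P, of "Q u - Q v"] by (simp add: dist_norm linear_simps(2)[OF P])
    also have "\<dots> \<le> onorm P * (K * dist u v)"
      using onorm_pos_le[OF P] lipschitz_onD[OF r(2) uv] by (intro mult_left_mono)
    finally show "dist (P (Q u)) (P (Q v)) \<le> onorm P * K * dist u v" by simp
  next
    show "0 \<le> onorm P * K" using onorm_pos_le[OF P] lipschitz_on_nonneg[OF r(2)] by simp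
  qed
  then show "\<exists>r>0. \<exists>K. K-lipschitz_on (cball x r) (\<lambda>x. P (Q x))" using r(1) by blast
qed

text \<open>All fields occurring in the approximation have this form, with \<open>A\<close> made of blocks of
  \<open>L\<close> and \<open>P\<close> of projections.\<close>

lemma permissible_field_flow:
  assumes F: "permissible_decomposition F L Q" and A: "bounded_linear A" and P: "bounded_linear P"
    and G: "\<And>x. G x = A x + P (Q x)"
  shows "\<exists>!\<phi>. generates_flow G \<phi>"
proof -
  have "\<exists>a1>0. \<exists>a2>0. \<forall>x. norm (Q x) \<le> a1 * norm x + a2 / (1 + norm x)"
    and Q: "local_lipschitz (UNIV :: real set) UNIV (\<lambda>_. Q)"
    using F unfolding permissible_decomposition_def by blast+
  then obtain a1 a2 where a: "a1 > 0" "a2 > 0" "\<And>x. norm (Q x) \<le> a1 * norm x + a2 / (1 + norm x)" by meson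
  have Qle: "norm (Q x) \<le> a1 * norm x + a2" for x
  proof -
    have "a2 / (1 + norm x) \<le> a2 / 1" using a(2) by (intro divide_left_mono) (simp_all add: add_pos_nonneg)
    then show ?thesis using a(3)[of x] by simp
  qed
  have "norm (G x) \<le> (onorm A + onorm P * a1) * norm x + onorm P * a2" for x
  proof -
    have "norm (G x) \<le> norm (A x) + norm (P (Q x))" unfolding G by (rule norm_triangle_ineq)
    moreover have "norm (A x) \<le> onorm A * norm x" by (rule onorm[OF A])
    moreover have "norm (P (Q x)) \<le> onorm P * norm (Q x)" by (rule onorm[OF P])
    moreover have "onorm P * norm (Q x) \<le> onorm P * (a1 * norm x + a2)"
      using onorm_pos_le[OF P] Qle by (intro mult_left_mono)
    ultimately show ?thesis by (simp add: algebra_simps)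
  qed
  moreover have "locally_lipschitz G"
    unfolding ext[OF G]
    by (intro locally_lipschitz_add bounded_linear_locally_lipschitz A
        locally_lipschitz_compose[OF P] local_lipschitz_imp_locally_lipschitz[OF Q])
  moreover have "0 \<le> onorm A + onorm P * a1" "0 \<le> onorm P * a2"
    using onorm_pos_le[OF A] onorm_pos_le[OF P] a by simp_all
  ultimately show ?thesis by (intro flow_exists_unique)
qed

text \<open>The growth bound without an inhomogeneous term, applied in both directions of time.\<close>

lemma zero_trajectory:
  fixes w :: "real \<Rightarrow> 'a::real_inner"
  assumes w: "\<And>t. (w has_vector_derivative w' t) (at t)"
    and le: "\<And>t. norm (w' t) \<le> a * norm (w t)" and a: "0 \<le> a" and init: "w 0 = 0"
  shows "w t = 0"
proof -
  have forward: "y T = 0" if T: "0 \<le> T" and y: "\<And>t. (y has_vector_derivative y' t) (at t)"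
    and yle: "\<And>t. norm (y' t) \<le> a * norm (y t)" and y0: "y 0 = 0"
    for T and y y' :: "real \<Rightarrow> 'a"
  proof -
    have "(norm (y T))\<^sup>2 \<le> exp ((2 * a + 1) * T) * ((norm (y 0))\<^sup>2 + 0\<^sup>2 * T)"
    proof (rule norm_growth_bound[where w' = y', OF T a])
      show "(y has_vector_derivative y' t) (at t within {0..T})" for t
        using y by (rule has_vector_derivative_at_within)
    qed (use yle in auto)
    then show ?thesis by (simp add: y0)
  qed
  show ?thesis
  proof (cases "t \<ge> 0")
    case True
    then show ?thesis using forward[OF _ w le init] by blast
  next
    case False
    have "((\<lambda>s. w (- s)) has_vector_derivative - w' (- s)) (at s)" for s
      by (rule has_vector_derivative_reverse) (use w in \<open>auto intro: has_vector_derivative_at_within\<close>)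
    moreover have "norm (- w' (- s)) \<le> a * norm (w (- s))" for s using le by simp
    ultimately have "w (- (- t)) = 0"
      using forward[of "- t" "\<lambda>s. w (- s)" "\<lambda>s. - w' (- s)"] False init by simp
    then show ?thesis by simp
  qed
qed

lemma orth_proj_complement:
  fixes V W U :: "'a::real_inner set"
  assumes V: "finite_dim_subspace V" and W: "finite_dim_subspace W" and dec: "orth_decomp W V U"
  shows "orth_proj U x = orth_proj W x - orth_proj V x"
proof (rule orth_proj_eqI)
  have U: "subspace U" and VU: "\<And>v u. v \<in> V \<Longrightarrow> u \<in> U \<Longrightarrow> v \<bullet> u = 0"
    and Weq: "W = {v + u |v u. v \<in> V \<and> u \<in> U}" and V0: "subspace V"
    using dec by (auto simp: orth_decomp_def orthogonal_def)
  show "subspace U" by (rule U)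
  have VW: "V \<subseteq> W" unfolding Weq using subspace_0[OF U] by force
  have UW: "U \<subseteq> W" unfolding Weq using subspace_0[OF V0] by force
  obtain v u where vu: "v \<in> V" "u \<in> U" "orth_proj W x = v + u"
    using orth_proj_in[OF W, of x] unfolding Weq by auto
  have "orth_proj V x = v"
  proof (rule orth_proj_eqI[OF V0 vu(1)])
    fix y assume y: "y \<in> V"
    have "(x - orth_proj W x) \<bullet> y = 0" using y VW by (intro orth_proj_orthogonal[OF W]) auto
    moreover have "u \<bullet> y = 0" using VU[OF y vu(2)] by (simp add: inner_commute)
    ultimately show "(x - v) \<bullet> y = 0" by (simp add: vu(3) inner_diff_left inner_add_left)
  qed
  then show "orth_proj W x - orth_proj V x \<in> U" using vu by simp
  fix y assume y: "y \<in> U"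
  have "(x - orth_proj W x) \<bullet> y = 0" using y UW by (intro orth_proj_orthogonal[OF W]) auto
  moreover have "orth_proj V x \<bullet> y = 0" using VU[OF orth_proj_in[OF V] y] .
  ultimately show "(x - (orth_proj W x - orth_proj V x)) \<bullet> y = 0"
    by (simp add: inner_diff_left inner_add_left)
qed

lemma suitable_finite_dim: "suitable L Q X c1 c2 V \<Longrightarrow> finite_dim_subspace V"
  by (simp add: suitable_def)

lemma suitable_compact_part:
  assumes "suitable L Q X c1 c2 V" "x \<in> X"
  shows "norm (Q x - orth_proj V (Q x)) \<le> c2"
proof -
  have "ereal (norm (Q x - orth_proj V (Q x))) \<le> (SUP x\<in>X. ereal (norm (Q x - orth_proj V (Q x))))"
    using assms(2) by (rule SUP_upper)
  also have "\<dots> \<le> ereal c2" using assms(1) by (simp add: suitable_def)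
  finally show ?thesis by simp
qed

context
  fixes L Q :: "'a::{real_inner, complete_space} \<Rightarrow> 'a" and X :: "'a set" and c1 c2 :: real
  assumes L: "bounded_linear L"
begin

interpretation L: bounded_linear L by (rule L)

lemma suitable_commutator:
  assumes "suitable L Q X c1 c2 V"
  shows "norm (orth_proj V (L x) - L (orth_proj V x)) \<le> c1 * norm x"
proof -
  let ?C = "\<lambda>x. orth_proj V (L x) - L (orth_proj V x)"
  have p: "bounded_linear (orth_proj V)"
    by (rule bounded_linear_orth_proj[OF suitable_finite_dim[OF assms]])
  have "bounded_linear ?C"
    by (intro bounded_linear_sub bounded_linear_compose[OF p L] bounded_linear_compose[OF L p])
  then have "norm (?C x) \<le> onorm ?C * norm x" by (rule onorm)
  also have "\<dots> \<le> c1 * norm x" using assms by (intro mult_right_mono) (auto simp: suitable_def)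
  finally show ?thesis .
qed

text \<open>Up to sign, the off-diagonal blocks of \<open>L\<close> are the commutator \<open>C\<close> of \<open>L\<close> with
  the projection, composed with the projection or its complement.\<close>

lemma block_diagonal_near:
  assumes V: "suitable L Q X c1 c2 V"
  defines "p \<equiv> orth_proj V"
  shows "norm (p (L (p x)) + (L (x - p x) - p (L (x - p x))) - L x) \<le> 2 * c1 * norm x"
proof -
  note fd = suitable_finite_dim[OF V]
  have pp: "p (p y) = p y" for y unfolding p_def by (rule orth_proj_fixes[OF fd orth_proj_in[OF fd]])
  have pd: "p (y - z) = p y - p z" for y z
    unfolding p_def by (rule linear_diff[OF linear_orth_proj[OF fd]])
  define C where "C y = p (L y) - L (p y)" for y
  have c1: "0 \<le> c1 * norm x"
    using order_trans[OF norm_ge_zero suitable_commutator[OF V, of x]] .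
  have C: "norm (C y) \<le> c1 * norm x" if "norm y \<le> norm x" for y
  proof (cases "x = 0")
    case True
    then show ?thesis using that by (simp add: C_def p_def linear_0[OF linear_orth_proj[OF fd]])
  next
    case False
    then have "0 \<le> c1" using c1 by (simp add: zero_le_mult_iff)
    then have "c1 * norm y \<le> c1 * norm x" using that by (intro mult_left_mono)
    then show ?thesis using suitable_commutator[OF V, of y] by (simp add: C_def p_def)
  qed
  have "p (L (p x)) + (L (x - p x) - p (L (x - p x))) - L x = C (p x) - C (x - p x)"
    by (simp add: C_def pp pd L.diff)
  then show ?thesis
    using norm_triangle_ineq4[of "C (p x)" "C (x - p x)"] C[of "p x"] C[of "x - p x"]
      norm_orth_proj_le[OF fd, of x] norm_orth_proj_compl_le[OF fd, of x] by (simp add: p_def)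
qed

lemma approx_field_near:
  assumes V: "suitable L Q X c1 c2 V" and x: "x \<in> X"
  shows "norm (approx_field L Q V x - (L x + Q x)) \<le> 2 * c1 * norm x + c2"
proof -
  let ?p = "orth_proj V"
  have eq: "approx_field L Q V x - (L x + Q x)
      = (?p (L (?p x)) + (L (x - ?p x) - ?p (L (x - ?p x))) - L x) - (Q x - ?p (Q x))"
    by (simp add: approx_field_def Let_def)
  show ?thesis unfolding eq
    using norm_triangle_ineq4[of "?p (L (?p x)) + (L (x - ?p x) - ?p (L (x - ?p x))) - L x" "Q x - ?p (Q x)"]
      block_diagonal_near[OF V, of x] suitable_compact_part[OF V x]
    by linarith
qed

lemma approx_field2_near:
  assumes V: "suitable L Q X c1 c2 V" and W: "suitable L Q X c1 c2 W" and dec: "orth_decomp W V U"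
    and x: "x \<in> X" and c1: "0 \<le> c1"
  shows "norm (approx_field2 L Q V U W x - (L x + Q x)) \<le> 4 * c1 * norm x + c2"
proof -
  note fdV = suitable_finite_dim[OF V] and fdW = suitable_finite_dim[OF W]
  define p where "p = orth_proj V"
  define r where "r = orth_proj W"
  define q where "q = orth_proj U"
  have q: "q y = r y - p y" for y
    unfolding q_def r_def p_def by (rule orth_proj_complement[OF fdV fdW dec])
  have VW: "V \<subseteq> W"
  proof
    fix v assume "v \<in> V"
    moreover have "0 \<in> U" using dec by (auto simp: orth_decomp_def subspace_0)
    ultimately show "v \<in> W" using dec by (auto simp: orth_decomp_def intro: exI[of _ v] exI[of _ 0])
  qed
  have pp: "p (p y) = p y" for y unfolding p_def by (rule orth_proj_fixes[OF fdV orth_proj_in[OF fdV]])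
  have rp: "r (p y) = p y" for y
    unfolding p_def r_def using orth_proj_in[OF fdV] VW by (intro orth_proj_fixes[OF fdW]) auto
  have pd: "p (y - z) = p y - p z" for y z
    unfolding p_def by (rule linear_diff[OF linear_orth_proj[OF fdV]])
  have rd: "r (y - z) = r y - r z" for y z
    unfolding r_def by (rule linear_diff[OF linear_orth_proj[OF fdW]])
  have pr: "p (r y) = p y" for y
  proof -
    have "p (y - r y) = 0" unfolding p_def r_def using VW
      by (intro orth_proj_eq_0[OF fdV] orth_proj_orthogonal[OF fdW]) auto
    then show ?thesis by (simp add: pd)
  qed
  define C where "C y = p (L y) - L (p y)" for y
  have C: "norm (C y) \<le> c1 * norm x" if "norm y \<le> norm x" for y
  proof -
    have "c1 * norm y \<le> c1 * norm x" using that c1 by (intro mult_left_mono)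
    then show ?thesis using suitable_commutator[OF V, of y] by (simp add: C_def p_def)
  qed
  have "norm (q x) \<le> norm x"
  proof -
    have "q x = r x - p (r x)" by (simp add: q pr)
    then show ?thesis
      using norm_orth_proj_compl_le[OF fdV, of "r x"] norm_orth_proj_le[OF fdW, of x]
      by (simp add: p_def r_def)
  qed
  then have Cq: "norm (C (q x)) \<le> c1 * norm x" by (rule C)
  have Cp: "norm (r (C (p x))) \<le> c1 * norm x"
    using norm_orth_proj_le[OF fdW, of "C (p x)"] C[of "p x"] norm_orth_proj_le[OF fdV, of x]
    by (simp add: r_def p_def)
  let ?B = "r (L (r x)) + (L (x - r x) - r (L (x - r x))) - L x"
  \<comment> \<open>Passing from the block of \<open>W\<close> to those of \<open>V\<close> and \<open>U\<close> drops two off-diagonal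
    blocks. Up to sign, each is the commutator with the projection onto \<open>V\<close>, composed with
    projections.\<close>
  have blocks: "p (L (p x)) + q (L (q x)) = r (L (r x)) - C (q x) + r (C (p x))"
    by (simp add: C_def q pp rp pr pd rd L.diff)
  have eq: "approx_field2 L Q V U W x - (L x + Q x)
      = ((?B - C (q x)) + r (C (p x))) - (Q x - p (Q x))"
    unfolding approx_field2_def Let_def p_def[symmetric] q_def[symmetric] r_def[symmetric] blocks
    by (simp add: algebra_simps)
  have "norm ?B \<le> 2 * c1 * norm x" using block_diagonal_near[OF W, of x] by (simp add: r_def)
  moreover have "norm (Q x - p (Q x)) \<le> c2" using suitable_compact_part[OF V x] by (simp add: p_def)
  ultimately show ?thesis unfolding eq
    using norm_triangle_ineq4[of "(?B - C (q x)) + r (C (p x))" "Q x - p (Q x)"]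
      norm_triangle_ineq[of "?B - C (q x)" "r (C (p x))"] norm_triangle_ineq4[of ?B "C (q x)"] Cq Cp
    by linarith
qed

text \<open>The vector \<open>u\<close> is orthogonal to \<open>V\<close>, hence to the kernel of \<open>L\<close>, so
  \<open>L u\<close> is not small compared to \<open>u\<close>. The components of \<open>L u\<close> in \<open>V\<close> and
  in the complement of \<open>W\<close> are commutators applied to \<open>u\<close>. Being small, they leave a
  non-zero component in \<open>U\<close>.\<close>

lemma complement_no_kernel:
  assumes V: "suitable L Q X c1 c2 V" and W: "suitable L Q X c1 c2 W" and dec: "orth_decomp W V U"
    and below: "\<And>u. (\<And>k. L k = 0 \<Longrightarrow> u \<bullet> k = 0) \<Longrightarrow> norm u \<le> c * norm (L u)"
    and c: "0 < c" "2 * c * c1 < 1" and u: "u \<in> U" "orth_proj U (L u) = 0"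
  shows "u = 0"
proof -
  note fdV = suitable_finite_dim[OF V] and fdW = suitable_finite_dim[OF W]
  have VU: "u \<bullet> v = 0" if "v \<in> V" for v
    using dec u(1) that by (auto simp: orth_decomp_def orthogonal_def inner_commute)
  have "0 \<in> V" using finite_dim_subspace_imp_subspace[OF fdV] by (rule subspace_0)
  then have "u \<in> W" using dec u(1) by (auto simp: orth_decomp_def intro: exI[of _ 0] exI[of _ u])
  then have ru: "orth_proj W u = u" by (rule orth_proj_fixes[OF fdW])
  have pu: "orth_proj V u = 0" using VU by (rule orth_proj_eq_0[OF fdV])
  have "orth_proj W (L u) = orth_proj V (L u)"
    using u(2) orth_proj_complement[OF fdV fdW dec, of "L u"] by simp
  then have "norm (L u) \<le> norm (orth_proj V (L u)) + norm (orth_proj W (L u) - L u)"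
    using norm_triangle_ineq4[of "orth_proj V (L u)" "orth_proj W (L u) - L u"] by simp
  also have "\<dots> \<le> c1 * norm u + c1 * norm u"
    using suitable_commutator[OF V, of u] suitable_commutator[OF W, of u]
    by (intro add_mono) (simp_all add: ru pu L.zero)
  finally have "c * norm (L u) \<le> c * (c1 * norm u + c1 * norm u)" using c(1) by (intro mult_left_mono) auto
  moreover have "norm u \<le> c * norm (L u)"
  proof (rule below)
    show "u \<bullet> k = 0" if "L k = 0" for k using V that by (intro VU) (auto simp: suitable_def)
  qed
  ultimately have "(1 - 2 * c * c1) * norm u \<le> 0" by (simp add: algebra_simps)
  then show ?thesis using c(2) by (simp add: mult_le_0_iff)
qed

text \<open>The component \<open>w\<close> of a trajectory orthogonal to \<open>V\<close> obeys a linear equation of its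
  own, because the field is block diagonal up to the term with values in \<open>V\<close>.\<close>

lemma approx_flow_preserves:
  assumes V: "finite_dim_subspace V" and \<phi>: "generates_flow (approx_field L Q V) \<phi>" and x: "x \<in> V"
  shows "\<phi> x t \<in> V"
proof -
  define p where "p = orth_proj V"
  have p: "bounded_linear p" unfolding p_def by (rule bounded_linear_orth_proj[OF V])
  interpret p: bounded_linear p by (rule p)
  have pp: "p (p y) = p y" for y unfolding p_def by (rule orth_proj_fixes[OF V orth_proj_in[OF V]])
  define w where "w t = \<phi> x t - p (\<phi> x t)" for t
  have "w t = 0"
  proof (rule zero_trajectory)
    show "(w has_vector_derivative - (L (w t) - p (L (w t)))) (at t)" for t
    proof -
      let ?G = "approx_field L Q V (\<phi> x t)"
      have "(\<phi> x has_vector_derivative - ?G) (at t)" using \<phi> by (simp add: generates_flow_def)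
      then have "(w has_vector_derivative - ?G - p (- ?G)) (at t)"
        unfolding w_def by (intro has_vector_derivative_diff p.has_vector_derivative)
      moreover have "- ?G - p (- ?G) = - (L (w t) - p (L (w t)))"
        unfolding approx_field_def Let_def p_def[symmetric] w_def
        by (simp add: p.add p.diff p.neg pp)
      ultimately show ?thesis by simp
    qed
    show "norm (- (L (w t) - p (L (w t)))) \<le> onorm L * norm (w t)" for t
      using norm_orth_proj_compl_le[OF V, of "L (w t)"] onorm[OF L, of "w t"]
      unfolding p_def norm_minus_cancel by (rule order_trans)
    show "0 \<le> onorm L" by (rule onorm_pos_le[OF L])
    show "w 0 = 0" using \<phi> orth_proj_fixes[OF V x] by (simp add: w_def p_def generates_flow_def)
  qed
  then have "\<phi> x t = p (\<phi> x t)" by (simp add: w_def)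
  then show ?thesis using orth_proj_in[OF V, of "\<phi> x t"] by (simp add: p_def)
qed

lemma approx_flow_conley_index:
  assumes V: "finite_dim_subspace V" and \<phi>: "generates_flow (approx_field L Q V) \<phi>"
    and X: "isolating_nbhd_in UNIV X \<phi>"
  shows "conley_index_defined V X \<phi>"
proof -
  have clX: "closed X" and bdX: "bounded X" and invX: "inv_set X \<phi> \<subseteq> interior X"
    using X by (simp_all add: isolating_nbhd_in_def flip: closed_closedin)
  have "compact (X \<inter> V)"
    by (rule finite_dim_compact[OF V])
       (auto intro: closed_Int clX closed_finite_dim_subspace[OF V] bounded_subset[OF bdX])
  moreover have "inv_set (X \<inter> V) \<phi> \<subseteq> (top_of_set V) interior_of (X \<inter> V)"
  proof
    fix x assume x: "x \<in> inv_set (X \<inter> V) \<phi>"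
    then have "x \<in> inv_set X \<phi>" by (auto simp: inv_set_def)
    then have "x \<in> V \<inter> interior X" using x invX by (auto simp: inv_set_def)
    moreover have "V \<inter> interior X \<subseteq> (top_of_set V) interior_of (X \<inter> V)"
      using interior_subset[of X] by (intro interior_of_maximal) (auto intro: openin_open_Int)
    ultimately show "x \<in> (top_of_set V) interior_of (X \<inter> V)" by blast
  qed
  moreover have "closedin (top_of_set V) (X \<inter> V)" using clX by (metis closedin_closed_Int inf_commute)
  moreover have "bounded (X \<inter> V)" using bdX by (rule bounded_subset) auto
  ultimately show ?thesis
    using V approx_flow_preserves[OF V \<phi>] by (simp add: conley_index_defined_def isolating_nbhd_in_def)
qed

lemma bounded_linear_block_diagonal:
  assumes "finite_dim_subspace V"
  defines "p \<equiv> orth_proj V"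
  shows "bounded_linear (\<lambda>x. p (L (p x)))" "bounded_linear (\<lambda>x. L (x - p x) - p (L (x - p x)))"
proof -
  have p: "bounded_linear p" unfolding p_def by (rule bounded_linear_orth_proj[OF assms(1)])
  have i: "bounded_linear (\<lambda>x. x - p x)" by (intro bounded_linear_sub bounded_linear_ident p)
  show "bounded_linear (\<lambda>x. p (L (p x)))"
    by (rule bounded_linear_compose[OF p bounded_linear_compose[OF L p]])
  show "bounded_linear (\<lambda>x. L (x - p x) - p (L (x - p x)))"
    by (intro bounded_linear_sub bounded_linear_compose[OF L i]
        bounded_linear_compose[OF p bounded_linear_compose[OF L i]])
qed

end

lemma approx_field_flow:
  assumes F: "permissible_decomposition F L Q" and V: "finite_dim_subspace V"
  shows "\<exists>!\<phi>. generates_flow (approx_field L Q V) \<phi>"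
proof (rule permissible_field_flow[OF F])
  have L: "bounded_linear L" using F by (simp add: permissible_decomposition_def)
  show "bounded_linear (\<lambda>x. orth_proj V (L (orth_proj V x))
      + (L (x - orth_proj V x) - orth_proj V (L (x - orth_proj V x))))"
    by (intro bounded_linear_add bounded_linear_block_diagonal[OF L V])
  show "bounded_linear (orth_proj V)" by (rule bounded_linear_orth_proj[OF V])
  show "approx_field L Q V x = orth_proj V (L (orth_proj V x))
      + (L (x - orth_proj V x) - orth_proj V (L (x - orth_proj V x))) + orth_proj V (Q x)" for x
    by (simp add: approx_field_def Let_def)
qed

lemma interpolated_field_flow:
  assumes F: "permissible_decomposition F L Q" and V: "finite_dim_subspace V"
    and W: "finite_dim_subspace W" and dec: "orth_decomp W V U"
  shows "\<exists>!\<phi>. generates_flow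
    (\<lambda>x. s *\<^sub>R approx_field2 L Q V U W x + (1 - s) *\<^sub>R approx_field L Q W x) \<phi>"
proof (rule permissible_field_flow[OF F])
  let ?p = "orth_proj V" and ?q = "orth_proj U" and ?r = "orth_proj W"
  let ?B = "\<lambda>x. L (x - ?r x) - ?r (L (x - ?r x))"
  have L: "bounded_linear L" using F by (simp add: permissible_decomposition_def)
  have p: "bounded_linear ?p" and r: "bounded_linear ?r"
    by (rule bounded_linear_orth_proj[OF V], rule bounded_linear_orth_proj[OF W])
  have q: "bounded_linear ?q"
    unfolding ext[OF orth_proj_complement[OF V W dec]] by (intro bounded_linear_sub r p)
  have qLq: "bounded_linear (\<lambda>x. ?q (L (?q x)))"
    by (rule bounded_linear_compose[OF q bounded_linear_compose[OF L q]])
  show "bounded_linear (\<lambda>x. s *\<^sub>R (?p (L (?p x)) + ?q (L (?q x)) + ?B x)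
      + (1 - s) *\<^sub>R (?r (L (?r x)) + ?B x))"
    by (intro bounded_linear_add bounded_linear_const_scaleR
        bounded_linear_block_diagonal[OF L V] bounded_linear_block_diagonal[OF L W] qLq)
  show "bounded_linear (\<lambda>y. s *\<^sub>R ?p y + (1 - s) *\<^sub>R ?r y)"
    by (intro bounded_linear_add bounded_linear_const_scaleR p r)
  show "s *\<^sub>R approx_field2 L Q V U W x + (1 - s) *\<^sub>R approx_field L Q W x
    = s *\<^sub>R (?p (L (?p x)) + ?q (L (?q x)) + ?B x) + (1 - s) *\<^sub>R (?r (L (?r x)) + ?B x)
      + (s *\<^sub>R ?p (Q x) + (1 - s) *\<^sub>R ?r (Q x))" for x
    by (simp add: approx_field_def approx_field2_def Let_def scaleR_add_right)
qed

theorem proposition4: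
  fixes F L Q :: "'a::{real_inner, complete_space} \<Rightarrow> 'a"
    and \<eta> :: "'a \<Rightarrow> real \<Rightarrow> 'a"
    and X :: "'a set"
  assumes "permissible_decomposition F L Q"
    and "generates_flow F \<eta>"
    and "isolating_nbhd_in UNIV X \<eta>"
  shows "\<exists>c1>0. \<exists>c2>0.
    (\<forall>V. suitable L Q X c1 c2 V \<longrightarrow>
       (\<exists>!\<eta>V. generates_flow (approx_field L Q V) \<eta>V) \<and>
       (\<forall>\<eta>V. generates_flow (approx_field L Q V) \<eta>V \<longrightarrow>
          isolating_nbhd_in UNIV X \<eta>V \<and> conley_index_defined V X \<eta>V)) \<and>
    (\<forall>V W U. suitable L Q X c1 c2 V \<and> suitable L Q X c1 c2 W \<and> orth_decomp W V U \<longrightarrow>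
       (\<forall>u\<in>U. orth_proj U (L u) = 0 \<longrightarrow> u = 0) \<and>
       (\<forall>s\<in>{0..1}.
          (\<exists>!\<phi>. generates_flow
             (\<lambda>x. s *\<^sub>R approx_field2 L Q V U W x + (1 - s) *\<^sub>R approx_field L Q W x) \<phi>) \<and>
          (\<forall>\<phi>. generates_flow
             (\<lambda>x. s *\<^sub>R approx_field2 L Q V U W x + (1 - s) *\<^sub>R approx_field L Q W x) \<phi> \<longrightarrow>
             isolating_nbhd_in UNIV X \<phi>)))"
proof -
  have L: "bounded_linear L" "self_adjoint L" "closed (range L)" and FLQ: "\<And>x. F x = L x + Q x"
    using assms(1) unfolding permissible_decomposition_def fredholm_def by blast+
  obtain \<epsilon> where \<epsilon>: "\<epsilon> > 0" and stable: "\<And>G \<phi>. generates_flow G \<phi> \<Longrightarrow>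
      (\<And>x. x \<in> X \<Longrightarrow> norm (G x - F x) \<le> \<epsilon>) \<Longrightarrow> isolating_nbhd_in UNIV X \<phi>"
    using isolation_stable[OF assms] by blast
  obtain c where c: "c > 0" "\<And>u. (\<And>k. L k = 0 \<Longrightarrow> u \<bullet> k = 0) \<Longrightarrow> norm u \<le> c * norm (L u)"
    using self_adjoint_closed_range_bounded_below[OF L] by blast
  have "bounded X" using assms(3) by (simp add: isolating_nbhd_in_def)
  then obtain R where R: "R > 0" "\<And>x. x \<in> X \<Longrightarrow> norm x \<le> R" unfolding bounded_pos by blast
  \<comment> \<open>The first bound on \<open>c1\<close> keeps all the fields within \<open>\<epsilon>\<close> of \<open>F\<close> on \<open>X\<close>,
    where they may differ by \<open>4 c1 R + c2\<close>; the second makes \<open>2 c c1 < 1\<close>, as the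
    statement about the kernel requires.\<close>
  define c1 where "c1 = min (\<epsilon> / (8 * R)) (1 / (4 * c))"
  define c2 where "c2 = \<epsilon> / 2"
  have pos: "c1 > 0" "c2 > 0" using \<epsilon> R(1) c(1) by (simp_all add: c1_def c2_def)
  have "c1 \<le> \<epsilon> / (8 * R)" by (simp add: c1_def)
  then have c1R: "4 * c1 * R \<le> \<epsilon> / 2" using R(1) by (simp add: pos_le_divide_eq)
  have "c1 \<le> 1 / (4 * c)" by (simp add: c1_def)
  then have "c1 * (4 * c) \<le> 1" using c(1) by (simp add: pos_le_divide_eq)
  then have c1c: "2 * c * c1 < 1" by (simp add: mult_ac)
  have budget: "4 * c1 * norm x + c2 \<le> \<epsilon>" if "x \<in> X" for x
  proof -
    have "4 * c1 * norm x \<le> 4 * c1 * R" using R(2)[OF that] pos(1) by (intro mult_left_mono) auto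
    then show ?thesis using c1R by (simp add: c2_def)
  qed
  have nearV: "norm (approx_field L Q V x - F x) \<le> \<epsilon>"
    if V: "suitable L Q X c1 c2 V" and x: "x \<in> X" for V x
  proof -
    have "2 * c1 * norm x \<le> 4 * c1 * norm x" using pos(1) by (intro mult_right_mono) auto
    then show ?thesis using approx_field_near[OF L(1) V x] budget[OF x] by (simp add: FLQ)
  qed
  have nearVW: "norm (s *\<^sub>R approx_field2 L Q V U W x + (1 - s) *\<^sub>R approx_field L Q W x - F x) \<le> \<epsilon>"
    if VW: "suitable L Q X c1 c2 V" "suitable L Q X c1 c2 W" "orth_decomp W V U"
      and s: "s \<in> {0..1}" and x: "x \<in> X" for V W U s x
  proof -
    \<comment> \<open>Balls are convex, so it suffices to consider the two ends of the family.\<close>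
    have "approx_field2 L Q V U W x \<in> cball (F x) \<epsilon>"
      using approx_field2_near[OF L(1) VW x] pos(1) budget[OF x]
      by (simp add: FLQ dist_norm norm_minus_commute)
    moreover have "approx_field L Q W x \<in> cball (F x) \<epsilon>"
      using nearV[OF VW(2) x] by (simp add: dist_norm norm_minus_commute)
    ultimately have "s *\<^sub>R approx_field2 L Q V U W x + (1 - s) *\<^sub>R approx_field L Q W x \<in> cball (F x) \<epsilon>"
      using s by (intro convexD[OF convex_cball]) auto
    then show ?thesis by (simp add: dist_norm norm_minus_commute)
  qed
  show ?thesis
  proof (rule exI[of _ c1], rule conjI[OF pos(1)], rule exI[of _ c2], rule conjI[OF pos(2)],
      intro conjI allI impI ballI; (elim conjE)?)
    fix V assume V: "suitable L Q X c1 c2 V"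
    note fd = suitable_finite_dim[OF V]
    show "\<exists>!\<eta>V. generates_flow (approx_field L Q V) \<eta>V" by (rule approx_field_flow[OF assms(1) fd])
    fix \<eta>V assume \<eta>V: "generates_flow (approx_field L Q V) \<eta>V"
    show iso: "isolating_nbhd_in UNIV X \<eta>V" using \<eta>V nearV[OF V] by (rule stable)
    show "conley_index_defined V X \<eta>V" by (rule approx_flow_conley_index[OF L(1) fd \<eta>V iso])
  next
    fix V W U
    assume V: "suitable L Q X c1 c2 V" and W: "suitable L Q X c1 c2 W" and dec: "orth_decomp W V U"
    note fd = suitable_finite_dim[OF V] suitable_finite_dim[OF W]
    show "u = 0" if "u \<in> U" "orth_proj U (L u) = 0" for u
      using c(2) by (rule complement_no_kernel[OF L(1) V W dec _ c(1) c1c that])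
    fix s :: real assume s: "s \<in> {0..1}"
    let ?G = "\<lambda>x. s *\<^sub>R approx_field2 L Q V U W x + (1 - s) *\<^sub>R approx_field L Q W x"
    show "\<exists>!\<phi>. generates_flow ?G \<phi>" by (rule interpolated_field_flow[OF assms(1) fd dec])
    show "isolating_nbhd_in UNIV X \<phi>" if "generates_flow ?G \<phi>" for \<phi>
      using that nearVW[OF V W dec s] by (rule stable)
  qed
qed

end
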